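(* Let $k\geqslant1$, $\vec\lambda\in I_k$ and $\lambda=\overrightarrow{\mathsf{type}}(\vec\lambda)$. If $d_{\vec\mu}\in\mathcal{U}_k$ is an element of the generalized conjugacy class $C_{\vec\mu}=\{x\in\mathcal{U}_k:\mathsf{cycletype}(x)=\vec\mu\}$ indexed by $\vec\mu\in I_k$, then $$\chi^{\vec\lambda}_{\mathcal{U}_k}(d_{\vec\mu})=\sum_{d\in C(d_{\vec\mu};\lambda)}\chi^{\vec\lambda}_{G_\lambda}(\sigma_d),$$ where - $C(d_{\vec\mu};\lambda)=\{d\in\mathcal{U}_k:\ d\geqslant d_{\vec\mu},\ \mathsf{top}(d)=\mathsf{bot}(d),\ \mathsf{type}(\mathsf{top}(d))=\lambda\}$, and - $\sigma_d$ is the unique element of $G_\lambda$ satisfying $d\,\ell_{\pi_\lambda}^{\mathsf{top}(d)}=\ell_{\pi_\lambda}^{\mathsf{top}(d)}\,\sigma_d$.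
   Context: $[k]=\{1,\dots,k\}$, $[\overline{k}]=\{\overline1,\dots,\overline k\}$, $\overline{\overline a}=a$, $\overline{B}=\{\overline a:a\in B\}$. $\mathcal{U}_k$ is the set of uniform block permutations: set partitions $d$ of $[k]\cup[\overline k]$ with $|B\cap[k]|=|B\cap[\overline k]|$ for every block $B$. $\mathsf{top}(d)$ has blocks $B\cap[k]$, $\mathsf{bot}(d)$ has blocks $\overline{B}\cap[k]$; $d$ is also viewed as the bijection $\mathsf{top}(d)\to\mathsf{bot}(d)$, $B\cap[k]\mapsto\overline B\cap[k]$. Product $dd'$: stack the two-row diagram of $d$ on top of that of $d'$, identify bottom vertex $\overline i$ of $d$ with top vertex $i$ of $d'$, take connected components, delete the middle vertices; $\mathcal{U}_k$ is a finite monoid. The order $d\geqslant d'$ is refinement of set partitions of $[k]\cup[\overline k]$: $d$ is coarser than or equal to $d'$ (every block of $d'$ is contained in a block of $d$). $\mathsf{type}(\pi)$ is the partition of block sizes of a set partition $\pi$ of $[k]$. For such $\pi$, $e_\pi=\{A\cup\overline A:A\in\pi\}$ (these are all the idempotents) and $G_{e_\pi}=\{d:\mathsf{top}(d)=\mathsf{bot}(d)=\pi\}$ is a group with identity $e_\pi$. $I_k=\{(\lambda^{(1)},\dots,\lambda^{(k)}):\lambda^{(i)}\text{ partitions},\ \sum_i i|\lambda^{(i)}|=k\}$; $\overrightarrow{\mathsf{type}}(\vec\lambda)=(1^{a_1}\cdots k^{a_k})$ with $a_i=|\lambda^{(i)}|$. For $\lambda=(1^{a_1}\cdots k^{a_k})\vdash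 k$, $\pi_\lambda$ is the set partition into blocks of consecutive integers whose sizes, from left to right, are $a_1$ ones, $a_2$ twos, etc.; $G_\lambda=G_{e_{\pi_\lambda}}\simeq\mathfrak{S}_{a_1}\times\cdots\times\mathfrak{S}_{a_k}$, permuting the blocks of each size. Cycle type: for $x\in\mathcal{U}_k$, $x^\omega$ is the unique idempotent among the positive powers of $x$, $x^{\omega+1}=x^\omega x\in G_{x^\omega}$; if $x^\omega=e_\pi$, then $\mathsf{cycletype}(x)=(\mu^{(1)},\dots,\mu^{(k)})$ with $\mu^{(i)}$ the cycle type of the permutation induced by $x^{\omega+1}$ on the blocks of $\pi$ of size $i$. Graded last letter order on blocks: $A\leqslant B$ if $|A|<|B|$, or $|A|=|B|$ and $\max A\leqslant\max B$. If $\gamma=\{\gamma_1<\cdots<\gamma_r\}$ and $\pi=\{\pi_1<\cdots<\pi_r\}$ have the same type, $\ell_\pi^\gamma\in\mathcal{U}_k$ is the bijection $\gamma\to\pi$, $\gamma_i\mapsto\pi_i$. $V^{\vec\lambda}_{G_\lambda}$ is the irreducible $G_\lambda$-representation that is the tensor product of the Specht modules indexed by $\lambda^{(i)}$ for the symmetric groups on the blocks of size $i$ of $\pi_\lambda$, and $\chi^{\vec\lambda}_{G_\lambda}$ is its character. $L_\lambda=\{d:\mathsf{bot}(d)=\pi_\lambda\}$, $m\odot\ell=m\ell$ if $m\ell\in L_\lambda$ and $0$ otherwise; $W^{\vec\lambda}_{\mathcal{U}_k}=\mathbb{C}L_\lambda\otimes_{\mathbb{C}G_\lambda}V^{\vec\lambda}_{G_\lambda}$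 with $d\cdot(\ell\otimes v)=(d\odot\ell)\otimes v$ is an irreducible $\mathcal{U}_k$-representation, and $\chi^{\vec\lambda}_{\mathcal{U}_k}$ is its character (trace). *)

theory Defs
  imports
    Complex_Main
    "HOL-Library.Multiset"
    "HOL-Library.FuncSet"
    "HOL-Library.Disjoint_Sets"
    "HOL-Library.Poly_Mapping"
    "HOL-Combinatorics.Permutations"
    "HOL-Combinatorics.Orbits"
    "HOL-Algebra.Group"
begin

section \<open>The monoid of uniform block permutations\<close>

text \<open>The vertex \<open>i\<close> of \<open>[k]\<close> is \<open>Top i\<close>, the vertex \<open>i\<close> with a bar is \<open>Bottom i\<close>. A diagram is the
  set of its blocks.\<close>

datatype vertex = Top nat | Bottom nat

type_synonym diagram = "vertex set set"

definition vertices :: "nat \<Rightarrow> vertex set" where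
  "vertices k = Top ` {1..k} \<union> Bottom ` {1..k}"

definition uniform_block_perms :: "nat \<Rightarrow> diagram set" where
  "uniform_block_perms k =
     {d. partition_on (vertices k) d \<and>
         (\<forall>B\<in>d. card (B \<inter> Top ` {1..k}) = card (B \<inter> Bottom ` {1..k}))}"

definition ubp_top :: "diagram \<Rightarrow> nat set set" where
  "ubp_top d = (\<lambda>B. Top -` B) ` d"

definition ubp_bot :: "diagram \<Rightarrow> nat set set" where
  "ubp_bot d = (\<lambda>B. Bottom -` B) ` d"

definition block_map :: "diagram \<Rightarrow> nat set \<Rightarrow> nat set" where
  "block_map d A = Bottom -` (THE B. B \<in> d \<and> Top -` B = A)"

definition block_map_inv :: "diagram \<Rightarrow> nat set \<Rightarrow> nat set" where
  "block_map_inv d A = Top -` (THE B. B \<in> d \<and> Bottom -` B = A)"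

text \<open>Stacking \<open>d\<close> on top of \<open>d'\<close> gives a graph on three rows of vertices. In it any two vertices
  of the same block of \<open>d\<close> or of \<open>d'\<close> are joined (in particular there is a loop at every vertex,
  so that the field of the edge relation consists of all the vertices of the stacked diagram).\<close>

datatype stacked_vertex = Upper nat | Middle nat | Lower nat

fun in_upper_half :: "vertex \<Rightarrow> stacked_vertex" where
  "in_upper_half (Top i) = Upper i"
| "in_upper_half (Bottom i) = Middle i"

fun in_lower_half :: "vertex \<Rightarrow> stacked_vertex" where
  "in_lower_half (Top i) = Middle i"
| "in_lower_half (Bottom i) = Lower i"

fun outer_vertex :: "vertex \<Rightarrow> stacked_vertex" where
  "outer_vertex (Top i) = Upper i"
| "outer_vertex (Bottom i) = Lower i"

definition stacked_edges :: "diagram \<Rightarrow> diagram \<Rightarrow> (stacked_vertex \<times> stacked_vertex) set" where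
  "stacked_edges d d' =
     {(in_upper_half u, in_upper_half v) | u v. \<exists>B\<in>d. u \<in> B \<and> v \<in> B} \<union>
     {(in_lower_half u, in_lower_half v) | u v. \<exists>B\<in>d'. u \<in> B \<and> v \<in> B}"

definition diagram_mult :: "diagram \<Rightarrow> diagram \<Rightarrow> diagram" where
  "diagram_mult d d' =
     (\<lambda>C. outer_vertex -` C) ` (Field (stacked_edges d d') // (stacked_edges d d')\<^sup>*) - {{}}"

definition ubp_idem :: "nat set set \<Rightarrow> diagram" where
  "ubp_idem \<pi> = (\<lambda>A. Top ` A \<union> Bottom ` A) ` \<pi>"

definition UBP :: "nat \<Rightarrow> diagram monoid" where
  "UBP k = \<lparr>carrier = uniform_block_perms k, mult = diagram_mult,
            one = ubp_idem ((\<lambda>i. {i}) ` {1..k})\<rparr>"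

definition coarser_eq :: "nat \<Rightarrow> diagram \<Rightarrow> diagram \<Rightarrow> bool" where
  "coarser_eq k d d' \<longleftrightarrow> refines (vertices k) d' d"

definition max_subgroup :: "nat \<Rightarrow> nat set set \<Rightarrow> diagram set" where
  "max_subgroup k \<pi> = {d \<in> carrier (UBP k). ubp_top d = \<pi> \<and> ubp_bot d = \<pi>}"


section \<open>Partitions, vector partitions and cycle types\<close>

text \<open>An integer partition is the multiset of its (positive) parts. A tuple indexed by \<open>[k]\<close>
  is a function that takes the value \<open>{#}\<close> outside \<open>[k]\<close>.\<close>

definition set_partition_type :: "nat set set \<Rightarrow> nat multiset" where
  "set_partition_type \<pi> = image_mset card (mset_set \<pi>)"

definition vector_partitions :: "nat \<Rightarrow> (nat \<Rightarrow> nat multiset) set" where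
  "vector_partitions k =
     {lams. (\<forall>i\<in>{1..k}. 0 \<notin># lams i) \<and> (\<forall>i. i \<notin> {1..k} \<longrightarrow> lams i = {#}) \<and>
          (\<Sum>i=1..k. i * sum_mset (lams i)) = k}"

definition vector_type :: "nat \<Rightarrow> (nat \<Rightarrow> nat multiset) \<Rightarrow> nat multiset" where
  "vector_type k lams = (\<Sum>i=1..k. replicate_mset (sum_mset (lams i)) i)"

definition canonical_set_partition :: "nat multiset \<Rightarrow> nat set set" where
  "canonical_set_partition lam =
     (let s = sorted_list_of_multiset lam in
      {{sum_list (take j s) + 1..sum_list (take (Suc j) s)} | j. j < length s})"

definition perm_cycle_type :: "('a \<Rightarrow> 'a) \<Rightarrow> 'a set \<Rightarrow> nat multiset" where
  "perm_cycle_type p S = image_mset card (mset_set (orbit p ` S))"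

definition ubp_omega :: "nat \<Rightarrow> diagram \<Rightarrow> diagram" where
  "ubp_omega k x =
     (THE e. (\<exists>n::nat. n > 0 \<and> e = x [^]\<^bsub>UBP k\<^esub> n) \<and> e \<otimes>\<^bsub>UBP k\<^esub> e = e)"

definition ubp_cycletype :: "nat \<Rightarrow> diagram \<Rightarrow> nat \<Rightarrow> nat multiset" where
  "ubp_cycletype k x =
     (let \<pi> = (THE \<pi>. partition_on {1..k} \<pi> \<and> ubp_omega k x = ubp_idem \<pi>)
      in (\<lambda>i. perm_cycle_type (block_map (ubp_omega k x \<otimes>\<^bsub>UBP k\<^esub> x)) {A \<in> \<pi>. card A = i}))"

definition gen_conj_class :: "nat \<Rightarrow> (nat \<Rightarrow> nat multiset) \<Rightarrow> diagram set" where
  "gen_conj_class k \<mu>s = {x \<in> carrier (UBP k). ubp_cycletype k x = \<mu>s}"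


section \<open>The order-preserving bijections between set partitions\<close>

definition graded_last_letter_le :: "nat set \<Rightarrow> nat set \<Rightarrow> bool" where
  "graded_last_letter_le A B \<longleftrightarrow> card A < card B \<or> (card A = card B \<and> Max A \<le> Max B)"

definition block_rank :: "nat set set \<Rightarrow> nat set \<Rightarrow> nat" where
  "block_rank \<pi> A = card {C \<in> \<pi>. graded_last_letter_le C A}"

text \<open>The \<open>i\<close>-th block of a set partition is its block of rank \<open>i\<close>. In \<open>ell \<gamma> \<pi>\<close> the first
  argument is the top and the second one the bottom of the diagram.\<close>

definition ell :: "nat set set \<Rightarrow> nat set set \<Rightarrow> diagram" where
  "ell \<gamma> \<pi> =
     {Top ` A \<union> Bottom ` B | A B. A \<in> \<gamma> \<and> B \<in> \<pi> \<and> block_rank \<gamma> A = block_rank \<pi> B}"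


section \<open>Free complex vector spaces and traces\<close>

text \<open>The free complex vector space on the type \<open>'a\<close> is \<open>'a \<Rightarrow>\<^sub>0 complex\<close>, with basis
  the elements \<open>single x 1\<close>. For \<open>X :: 'a set\<close> its subspace \<open>free_on X\<close> is the free vector space
  on \<open>X\<close>.\<close>

abbreviation basis_vec :: "'a \<Rightarrow> 'a \<Rightarrow>\<^sub>0 complex" where
  "basis_vec x \<equiv> Poly_Mapping.single x 1"

definition csmult :: "complex \<Rightarrow> ('a \<Rightarrow>\<^sub>0 complex) \<Rightarrow> ('a \<Rightarrow>\<^sub>0 complex)" where
  "csmult c p = Poly_Mapping.map (\<lambda>z. c * z) p"

lemma lookup_csmult: "Poly_Mapping.lookup (csmult c p) x = c * Poly_Mapping.lookup p x"
  by (simp add: csmult_def Poly_Mapping.map.rep_eq when_def)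

interpretation cvec: vector_space csmult
  by unfold_locales
    (auto intro!: poly_mapping_eqI simp: lookup_csmult lookup_add algebra_simps)

definition free_on :: "'a set \<Rightarrow> ('a \<Rightarrow>\<^sub>0 complex) set" where
  "free_on X = {p. Poly_Mapping.keys p \<subseteq> X}"

definition lin_ext :: "('a \<Rightarrow> 'b \<Rightarrow>\<^sub>0 complex) \<Rightarrow> ('a \<Rightarrow>\<^sub>0 complex) \<Rightarrow> 'b \<Rightarrow>\<^sub>0 complex" where
  "lin_ext f p = (\<Sum>x\<in>Poly_Mapping.keys p. csmult (Poly_Mapping.lookup p x) (f x))"

text \<open>For subspaces \<open>N \<subseteq> U\<close>, a finite set \<open>B \<subseteq> U\<close> of representatives of a basis of the quotient
  space \<open>U/N\<close>, the coordinates of the class of \<open>u\<close> with respect to this basis, and the trace of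
  the endomorphism of \<open>U/N\<close> induced by \<open>f\<close> (a linear map of \<open>U\<close> to itself that maps \<open>N\<close>
  to itself). For \<open>N = {0}\<close> these are the bases, coordinates and traces for \<open>U\<close> itself.\<close>

definition quotient_basis ::
  "('a \<Rightarrow>\<^sub>0 complex) set \<Rightarrow> ('a \<Rightarrow>\<^sub>0 complex) set \<Rightarrow> ('a \<Rightarrow>\<^sub>0 complex) set \<Rightarrow> bool" where
  "quotient_basis U N B \<longleftrightarrow>
     finite B \<and> B \<subseteq> U \<and>
     (\<forall>u\<in>U. \<exists>!c. (\<forall>b. b \<notin> B \<longrightarrow> c b = 0) \<and> u - (\<Sum>b\<in>B. csmult (c b) b) \<in> N)"

definition quotient_coord ::
  "('a \<Rightarrow>\<^sub>0 complex) set \<Rightarrow> ('a \<Rightarrow>\<^sub>0 complex) set \<Rightarrow> ('a \<Rightarrow>\<^sub>0 complex) \<Rightarrow>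
   ('a \<Rightarrow>\<^sub>0 complex) \<Rightarrow> complex" where
  "quotient_coord N B u =
     (THE c. (\<forall>b. b \<notin> B \<longrightarrow> c b = 0) \<and> u - (\<Sum>b\<in>B. csmult (c b) b) \<in> N)"

definition quotient_trace ::
  "('a \<Rightarrow>\<^sub>0 complex) set \<Rightarrow> ('a \<Rightarrow>\<^sub>0 complex) set \<Rightarrow>
   (('a \<Rightarrow>\<^sub>0 complex) \<Rightarrow> ('a \<Rightarrow>\<^sub>0 complex)) \<Rightarrow> complex" where
  "quotient_trace U N f =
     (let B = (SOME B. quotient_basis U N B) in \<Sum>b\<in>B. quotient_coord N B (f b) b)"


section \<open>Specht modules\<close>

text \<open>A tableau is the list of its rows (in English notation), a tabloid the list of the sets of
  entries of its rows. The Specht module is spanned by the polytabloids inside the permutation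
  module on the tabloids; so the one-row shapes give the trivial representations.\<close>

definition tableaux :: "'a set \<Rightarrow> nat multiset \<Rightarrow> 'a list list set" where
  "tableaux X \<mu> =
     {T. distinct (concat T) \<and> set (concat T) = X \<and>
         map length T = rev (sorted_list_of_multiset \<mu>)}"

definition tableau_column :: "'a list list \<Rightarrow> nat \<Rightarrow> 'a set" where
  "tableau_column T j = {row ! j | row. row \<in> set T \<and> j < length row}"

definition column_stabilizer :: "'a list list \<Rightarrow> ('a \<Rightarrow> 'a) set" where
  "column_stabilizer T =
     {\<sigma>. \<sigma> permutes set (concat T) \<and> (\<forall>j. \<sigma> ` tableau_column T j = tableau_column T j)}"

definition act_tabloid :: "('a \<Rightarrow> 'a) \<Rightarrow> 'a set list \<Rightarrow> 'a set list" where
  "act_tabloid \<sigma> t = map (\<lambda>R. \<sigma> ` R) t"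

definition polytabloid :: "'a list list \<Rightarrow> 'a set list \<Rightarrow>\<^sub>0 complex" where
  "polytabloid T =
     (\<Sum>\<sigma>\<in>column_stabilizer T.
        csmult (of_int (sign \<sigma>)) (basis_vec (act_tabloid \<sigma> (map set T))))"

definition specht_module :: "'a set \<Rightarrow> nat multiset \<Rightarrow> ('a set list \<Rightarrow>\<^sub>0 complex) set" where
  "specht_module X \<mu> = cvec.span (polytabloid ` tableaux X \<mu>)"


section \<open>The irreducible representations of the maximal subgroups\<close>

text \<open>The tensor product of subspaces of the free vector spaces on \<open>X\<^sub>1, \<dots>, X\<^sub>k\<close> is realised in
  the free vector space on the product of the \<open>X\<^sub>i\<close>, as the span of the pure tensors.\<close>

definition pure_tensor :: "nat \<Rightarrow> (nat \<Rightarrow> 'a \<Rightarrow>\<^sub>0 complex) \<Rightarrow> (nat \<Rightarrow> 'a) \<Rightarrow>\<^sub>0 complex" where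
  "pure_tensor k v =
     (\<Sum>t\<in>PiE {1..k} (\<lambda>i. Poly_Mapping.keys (v i)).
        csmult (\<Prod>i=1..k. Poly_Mapping.lookup (v i) (t i)) (basis_vec t))"

definition specht_tensor ::
  "nat \<Rightarrow> (nat \<Rightarrow> nat multiset) \<Rightarrow> ((nat \<Rightarrow> nat set set list) \<Rightarrow>\<^sub>0 complex) set" where
  "specht_tensor k lams =
     (let \<pi> = canonical_set_partition (vector_type k lams) in
      cvec.span {pure_tensor k v | v.
        \<forall>i\<in>{1..k}. v i \<in> specht_module {A \<in> \<pi>. card A = i} (lams i)})"

text \<open>As products of diagrams are read from top to bottom, \<open>block_map (g h)\<close> is
  \<open>block_map h \<circ> block_map g\<close>. The group elements therefore act from the left through the
  bijections from bottom to top.\<close>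

definition group_act ::
  "nat \<Rightarrow> diagram \<Rightarrow> ((nat \<Rightarrow> nat set set list) \<Rightarrow>\<^sub>0 complex) \<Rightarrow>
   ((nat \<Rightarrow> nat set set list) \<Rightarrow>\<^sub>0 complex)" where
  "group_act k g =
     lin_ext (\<lambda>t. basis_vec (\<lambda>i\<in>{1..k}. act_tabloid (block_map_inv g) (t i)))"

definition group_character :: "nat \<Rightarrow> (nat \<Rightarrow> nat multiset) \<Rightarrow> diagram \<Rightarrow> complex" where
  "group_character k lams g = quotient_trace (specht_tensor k lams) {0} (group_act k g)"


section \<open>The irreducible representations of the monoid\<close>

text \<open>The tensor product of a right module \<open>M\<close> and a left module \<open>V\<close> over a ring with set of
  elements \<open>R\<close> (here a complex algebra) is the quotient of the free vector space on \<open>M \<times> V\<close>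
  by the following subspace. The generator \<open>basis_vec (m, v)\<close> represents the tensor of
  \<open>m\<close> and \<open>v\<close>; the functions \<open>ract\<close> and \<open>lact\<close> are the actions of the ring. The relations for
  complex scalars are needed because the generators span a complex vector space rather than
  just an abelian group.\<close>

definition tensor_relations ::
  "('a \<Rightarrow>\<^sub>0 complex) set \<Rightarrow> 'r set \<Rightarrow> ('b \<Rightarrow>\<^sub>0 complex) set \<Rightarrow>
   (('a \<Rightarrow>\<^sub>0 complex) \<Rightarrow> 'r \<Rightarrow> ('a \<Rightarrow>\<^sub>0 complex)) \<Rightarrow>
   ('r \<Rightarrow> ('b \<Rightarrow>\<^sub>0 complex) \<Rightarrow> ('b \<Rightarrow>\<^sub>0 complex)) \<Rightarrow>
   ((('a \<Rightarrow>\<^sub>0 complex) \<times> ('b \<Rightarrow>\<^sub>0 complex)) \<Rightarrow>\<^sub>0 complex) set" where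
  "tensor_relations M R V ract lact = cvec.span (
     {basis_vec (m + m', v) - basis_vec (m, v) - basis_vec (m', v) | m m' v.
        m \<in> M \<and> m' \<in> M \<and> v \<in> V} \<union>
     {basis_vec (m, v + v') - basis_vec (m, v) - basis_vec (m, v') | m v v'.
        m \<in> M \<and> v \<in> V \<and> v' \<in> V} \<union>
     {basis_vec (csmult c m, v) - csmult c (basis_vec (m, v)) | c m v. m \<in> M \<and> v \<in> V} \<union>
     {basis_vec (m, csmult c v) - csmult c (basis_vec (m, v)) | c m v. m \<in> M \<and> v \<in> V} \<union>
     {basis_vec (ract m r, v) - basis_vec (m, lact r v) | m r v.
        m \<in> M \<and> r \<in> R \<and> v \<in> V})"

definition L_class :: "nat \<Rightarrow> nat multiset \<Rightarrow> diagram set" where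
  "L_class k lam = {d \<in> carrier (UBP k). ubp_bot d = canonical_set_partition lam}"

abbreviation G_group :: "nat \<Rightarrow> nat multiset \<Rightarrow> diagram set" where
  "G_group k lam \<equiv> max_subgroup k (canonical_set_partition lam)"

definition L_act :: "nat \<Rightarrow> nat multiset \<Rightarrow> diagram \<Rightarrow> (diagram \<Rightarrow>\<^sub>0 complex) \<Rightarrow> diagram \<Rightarrow>\<^sub>0 complex"
where
  "L_act k lam d =
     lin_ext (\<lambda>l. if d \<otimes>\<^bsub>UBP k\<^esub> l \<in> L_class k lam then basis_vec (d \<otimes>\<^bsub>UBP k\<^esub> l) else 0)"

definition L_right_act ::
  "nat \<Rightarrow> (diagram \<Rightarrow>\<^sub>0 complex) \<Rightarrow> (diagram \<Rightarrow>\<^sub>0 complex) \<Rightarrow> diagram \<Rightarrow>\<^sub>0 complex" where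
  "L_right_act k a r = lin_ext (\<lambda>l. lin_ext (\<lambda>g. basis_vec (l \<otimes>\<^bsub>UBP k\<^esub> g)) r) a"

definition group_algebra_act ::
  "nat \<Rightarrow> (diagram \<Rightarrow>\<^sub>0 complex) \<Rightarrow> ((nat \<Rightarrow> nat set set list) \<Rightarrow>\<^sub>0 complex) \<Rightarrow>
   ((nat \<Rightarrow> nat set set list) \<Rightarrow>\<^sub>0 complex)" where
  "group_algebra_act k r v = lin_ext (\<lambda>g. group_act k g v) r"

type_synonym induced_vec =
  "((diagram \<Rightarrow>\<^sub>0 complex) \<times> ((nat \<Rightarrow> nat set set list) \<Rightarrow>\<^sub>0 complex)) \<Rightarrow>\<^sub>0 complex"

text \<open>The representation induced from the maximal subgroup is the quotient of \<open>induced_gens\<close>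
  by \<open>induced_rels\<close>.\<close>

definition induced_gens :: "nat \<Rightarrow> (nat \<Rightarrow> nat multiset) \<Rightarrow> induced_vec set" where
  "induced_gens k lams =
     free_on (free_on (L_class k (vector_type k lams)) \<times> specht_tensor k lams)"

definition induced_rels :: "nat \<Rightarrow> (nat \<Rightarrow> nat multiset) \<Rightarrow> induced_vec set" where
  "induced_rels k lams =
     tensor_relations
       (free_on (L_class k (vector_type k lams)))
       (free_on (G_group k (vector_type k lams)))
       (specht_tensor k lams)
       (L_right_act k) (group_algebra_act k)"

definition induced_act ::
  "nat \<Rightarrow> (nat \<Rightarrow> nat multiset) \<Rightarrow> diagram \<Rightarrow> induced_vec \<Rightarrow> induced_vec" where
  "induced_act k lams d =
     lin_ext (\<lambda>(a, v). basis_vec (L_act k (vector_type k lams) d a, v))"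

definition monoid_character :: "nat \<Rightarrow> (nat \<Rightarrow> nat multiset) \<Rightarrow> diagram \<Rightarrow> complex" where
  "monoid_character k lams d =
     quotient_trace (induced_gens k lams) (induced_rels k lams) (induced_act k lams d)"


section \<open>The index set and the summands of the character formula\<close>

definition coarsenings :: "nat \<Rightarrow> diagram \<Rightarrow> nat multiset \<Rightarrow> diagram set" where
  "coarsenings k x lam =
     {d \<in> carrier (UBP k). coarser_eq k d x \<and> ubp_top d = ubp_bot d \<and>
        set_partition_type (ubp_top d) = lam}"

definition is_sigma :: "nat \<Rightarrow> nat multiset \<Rightarrow> diagram \<Rightarrow> diagram \<Rightarrow> bool" where
  "is_sigma k lam d \<sigma> \<longleftrightarrow> \<sigma> \<in> G_group k lam \<and>
     d \<otimes>\<^bsub>UBP k\<^esub> ell (ubp_top d) (canonical_set_partition lam) =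
     ell (ubp_top d) (canonical_set_partition lam) \<otimes>\<^bsub>UBP k\<^esub> \<sigma>"

definition sigma :: "nat \<Rightarrow> nat multiset \<Rightarrow> diagram \<Rightarrow> diagram" where
  "sigma k lam d = (THE \<sigma>. is_sigma k lam d \<sigma>)"

end

theory Submission
  imports Defs
begin

text \<open>Every \<open>l\<close> with bottom \<open>\<pi>\<close> (the canonical set partition) is uniquely \<open>ell \<gamma> \<pi> \<cdot> g\<close> with \<open>\<gamma>\<close> the top
  of \<open>l\<close> and \<open>g\<close> in the maximal subgroup at \<open>\<pi>\<close>, so the representation is the direct sum of copies
  of the Specht tensor product \<open>V\<close>, one for each \<open>\<gamma>\<close> of type \<open>lam\<close>. An element \<open>d\<close> contributes to its
  trace through those \<open>\<gamma>\<close> only for which \<open>d \<cdot> ell \<gamma> \<pi> = ell \<gamma> \<pi> \<cdot> \<sigma>\<close> for some \<open>\<sigma>\<close>, and then by the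
  character of \<open>\<sigma>\<close> on \<open>V\<close>. This happens exactly when the bottom of \<open>d\<close> refines \<open>\<gamma>\<close> and merging the blocks of
  \<open>d\<close> along \<open>\<gamma>\<close> gives a diagram with top \<open>\<gamma>\<close>; these merged diagrams are the coarsenings in the
  formula.\<close>

section \<open>Linear maps on free vector spaces\<close>

text \<open>The induced module is a quotient of the free space on all pairs of vectors, which has
  infinite dimension, and its trace is defined by an arbitrarily chosen basis. The trace is
  therefore computed with functionals that vanish on the relations and are dual to the tensors of a
  representative with a basis vector of \<open>V\<close>.

  Diagrams are treated as size-preserving bijections from bottom blocks to top blocks. In this
  direction a product becomes a composite in the same order, in agreement with the left action
  through \<open>block_map_inv\<close>. Products are evaluated only when the bottom of the upper
  factor refines the top of the lower one: then the upper bijection extends to unions of blocks,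
  uniformity makes the sizes add up, and the product keeps the bottom of the lower factor. If the
  refinement fails, two bottom blocks of the lower factor get joined, the product leaves the class
  \<open>L\<close>, and it counts as zero in the module.\<close>

abbreviation clinear :: "(('a \<Rightarrow>\<^sub>0 complex) \<Rightarrow> ('b \<Rightarrow>\<^sub>0 complex)) \<Rightarrow> bool" where
  "clinear \<equiv> Vector_Spaces.linear csmult csmult"

abbreviation cfunctional :: "(('a \<Rightarrow>\<^sub>0 complex) \<Rightarrow> complex) \<Rightarrow> bool" where
  "cfunctional \<equiv> Vector_Spaces.linear csmult (*)"

lemma cfunctionalI:
  assumes "\<And>u v. f (u + v) = f u + f v" and "\<And>c u. f (csmult c u) = c * f u"
  shows "cfunctional f"
  by unfold_locales (auto simp: assms algebra_simps)

lemma clinearI: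
  assumes "\<And>u v. f (u + v) = f u + f v" and "\<And>c u. f (csmult c u) = csmult c (f u)"
  shows "clinear f"
  by unfold_locales (auto simp: assms)

lemma linear_simps:
  assumes "Vector_Spaces.linear s t f"
  shows "f (u + v) = f u + f v" "f (u - v) = f u - f v" "f (s c u) = t c (f u)" "f 0 = 0"
    "f (sum h A) = (\<Sum>x\<in>A. f (h x))"
proof -
  interpret Vector_Spaces.linear s t f by fact
  show "f (u + v) = f u + f v" "f (u - v) = f u - f v" "f (s c u) = t c (f u)" "f 0 = 0"
    "f (sum h A) = (\<Sum>x\<in>A. f (h x))"
    by (simp_all add: add diff scale zero sum)
qed

lemma clinear_cfunctional_compose: "cfunctional f \<Longrightarrow> clinear g \<Longrightarrow> cfunctional (\<lambda>u. f (g u))"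
  by (rule cfunctionalI) (simp_all add: linear_simps)

lemma subspace_clinear_vimage:
  "clinear f \<Longrightarrow> cvec.subspace S \<Longrightarrow> cvec.subspace {u. f u \<in> S}"
  by (auto simp: cvec.subspace_def linear_simps)

lemma csmult_one [simp]: "csmult 1 p = p"
  by (rule cvec.scale_one)

lemma lookup_sum_csmult:
  "Poly_Mapping.lookup (\<Sum>x\<in>A. csmult (c x) (f x)) y = (\<Sum>x\<in>A. c x * Poly_Mapping.lookup (f x) y)"
  by (induction A rule: infinite_finite_induct) (auto simp: lookup_add lookup_csmult)

lemma keys_csmult: "Poly_Mapping.keys (csmult c p) \<subseteq> Poly_Mapping.keys p"
  by (auto simp: in_keys_iff lookup_csmult)

text \<open>The support of a sum can be smaller than the union of the supports, so linearity of
  \<open>lin_ext\<close> is checked with all sums taken over one common finite set.\<close>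

lemma lin_ext_eq_sum:
  assumes "finite S" "Poly_Mapping.keys p \<subseteq> S"
  shows "lin_ext f p = (\<Sum>x\<in>S. csmult (Poly_Mapping.lookup p x) (f x))"
  unfolding lin_ext_def using assms
  by (intro sum.mono_neutral_left) (auto simp: in_keys_iff)

lemma clinear_lin_ext: "clinear (lin_ext f)"
proof (rule clinearI)
  fix u v :: "'a \<Rightarrow>\<^sub>0 complex" and c
  let ?S = "Poly_Mapping.keys u \<union> Poly_Mapping.keys v"
  have S: "finite ?S" "Poly_Mapping.keys u \<subseteq> ?S" "Poly_Mapping.keys v \<subseteq> ?S"
    "Poly_Mapping.keys (u + v) \<subseteq> ?S"
    using Poly_Mapping.keys_add[of u v] by auto
  show "lin_ext f (u + v) = lin_ext f u + lin_ext f v"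
    using S by (simp add: lin_ext_eq_sum[of ?S] lookup_add cvec.scale_left_distrib sum.distrib)
  show "lin_ext f (csmult c u) = csmult c (lin_ext f u)"
    using keys_csmult[of c u]
    by (simp add: lin_ext_eq_sum[of "Poly_Mapping.keys u"] lookup_csmult cvec.scale_sum_right)
qed

lemmas lin_ext_simps = linear_simps[OF clinear_lin_ext]

lemma lin_ext_basis_vec [simp]: "lin_ext f (basis_vec x) = f x"
  by (simp add: lin_ext_def)

lemma lin_ext_basis_vec_id [simp]: "lin_ext basis_vec p = p"
  by (rule poly_mapping_eqI)
     (auto simp: lin_ext_def lookup_sum_csmult lookup_single when_def in_keys_iff
        if_distrib[where f = "\<lambda>x. _ * x"] sum.delta cong: if_cong)

lemma lin_ext_cong:
  "(\<And>x. x \<in> Poly_Mapping.keys p \<Longrightarrow> f x = g x) \<Longrightarrow> lin_ext f p = lin_ext g p"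
  by (simp add: lin_ext_def)

lemma clinear_lin_ext_compose: "clinear h \<Longrightarrow> h (lin_ext f p) = lin_ext (\<lambda>x. h (f x)) p"
  by (simp add: lin_ext_def linear_simps)

lemma lin_ext_zero_fun [simp]: "lin_ext (\<lambda>x. 0) p = 0"
  by (simp add: lin_ext_def)

lemma lin_ext_fun_add: "lin_ext (\<lambda>x. f x + g x) p = lin_ext f p + lin_ext g p"
  by (simp add: lin_ext_def cvec.scale_right_distrib sum.distrib)

lemma lin_ext_fun_csmult: "lin_ext (\<lambda>x. csmult c (f x)) p = csmult c (lin_ext f p)"
  by (simp add: lin_ext_def cvec.scale_sum_right mult.commute)

lemma lin_ext_lin_ext: "lin_ext f (lin_ext h p) = lin_ext (\<lambda>x. lin_ext f (h x)) p"
  by (rule clinear_lin_ext_compose[OF clinear_lin_ext])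

lemma clinear_eq_lin_ext: "clinear h \<Longrightarrow> h p = lin_ext (\<lambda>x. h (basis_vec x)) p"
  using clinear_lin_ext_compose[of h basis_vec p] by simp

lemma lin_ext_mem:
  assumes "cvec.subspace S" "\<And>x. x \<in> Poly_Mapping.keys p \<Longrightarrow> f x \<in> S"
  shows "lin_ext f p \<in> S"
  unfolding lin_ext_def using assms by (intro cvec.subspace_sum cvec.subspace_scale) auto

lemma subspace_free_on: "cvec.subspace (free_on X)"
proof (rule cvec.subspaceI)
  fix u v c assume "u \<in> free_on X" "v \<in> free_on X"
  then show "u + v \<in> free_on X" "csmult c u \<in> free_on X"
    using Poly_Mapping.keys_add[of u v] keys_csmult[of c u] by (auto simp: free_on_def)
qed (simp add: free_on_def)

lemma basis_vec_in_free_on [simp]: "basis_vec x \<in> free_on X \<longleftrightarrow> x \<in> X"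
  by (simp add: free_on_def)

lemma free_onD: "p \<in> free_on X \<Longrightarrow> x \<in> Poly_Mapping.keys p \<Longrightarrow> x \<in> X"
  by (auto simp: free_on_def)

lemma lin_ext_in_free_on:
  "p \<in> free_on X \<Longrightarrow> (\<And>x. x \<in> X \<Longrightarrow> f x \<in> free_on Y) \<Longrightarrow> lin_ext f p \<in> free_on Y"
  by (rule lin_ext_mem[OF subspace_free_on]) (auto simp: free_on_def)

lemma free_on_eq_span: "free_on X = cvec.span (basis_vec ` X)"
proof
  show "free_on X \<subseteq> cvec.span (basis_vec ` X)"
  proof
    fix p assume "p \<in> free_on X"
    then have "lin_ext basis_vec p \<in> cvec.span (basis_vec ` X)"
      by (intro lin_ext_mem) (auto simp: free_on_def intro: cvec.span_base)
    then show "p \<in> cvec.span (basis_vec ` X)" by simp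
  qed
  show "cvec.span (basis_vec ` X) \<subseteq> free_on X"
    by (intro cvec.span_minimal subspace_free_on) auto
qed

text \<open>For properties of expressions that are not linear in the vector, such as
  \<open>basis_vec (a, v)\<close> as a function of \<open>a\<close>.\<close>

lemma free_on_induct [consumes 1, case_names zero add scale basis]:
  assumes "p \<in> free_on X" and "P 0" and "\<And>u v. P u \<Longrightarrow> P v \<Longrightarrow> P (u + v)"
    and "\<And>c u. P u \<Longrightarrow> P (csmult c u)" and "\<And>x. x \<in> X \<Longrightarrow> P (basis_vec x)"
  shows "P p"
proof -
  have "cvec.span (basis_vec ` X) \<subseteq> {u. P u}"
    by (rule cvec.span_minimal) (auto simp: cvec.subspace_def assms)
  then show ?thesis using assms(1) by (auto simp: free_on_eq_span)
qed
section \<open>Traces on quotient spaces\<close>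

lemma quotient_basis_coord:
  assumes "quotient_basis U N B" "u \<in> U"
  shows "u - (\<Sum>b\<in>B. csmult (quotient_coord N B u b) b) \<in> N"
    and "\<lbrakk>\<And>b. b \<notin> B \<Longrightarrow> c b = 0; u - (\<Sum>b\<in>B. csmult (c b) b) \<in> N\<rbrakk> \<Longrightarrow> quotient_coord N B u = c"
proof -
  have ex1: "\<exists>!c. (\<forall>b. b \<notin> B \<longrightarrow> c b = 0) \<and> u - (\<Sum>b\<in>B. csmult (c b) b) \<in> N"
    using assms unfolding quotient_basis_def by blast
  show "u - (\<Sum>b\<in>B. csmult (quotient_coord N B u b) b) \<in> N"
    using theI'[OF ex1] unfolding quotient_coord_def by blast
  show "quotient_coord N B u = c"
    if "\<And>b. b \<notin> B \<Longrightarrow> c b = 0" "u - (\<Sum>b\<in>B. csmult (c b) b) \<in> N"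
    unfolding quotient_coord_def by (rule the1_equality[OF ex1]) (use that in blast)
qed

text \<open>A dual pair of families computes the trace: expand a basis \<open>B\<close> of the quotient in terms of
  the \<open>w i\<close> and the \<open>f (w i)\<close> in terms of \<open>B\<close>, and exchange the sums.\<close>

lemma quotient_trace_eq:
  fixes U N :: "('a \<Rightarrow>\<^sub>0 complex) set" and w :: "'i \<Rightarrow> 'a \<Rightarrow>\<^sub>0 complex"
  assumes N: "cvec.subspace N" and I: "finite I"
    and w: "\<And>i. i \<in> I \<Longrightarrow> w i \<in> U"
    and lin: "\<And>i. i \<in> I \<Longrightarrow> cfunctional (\<phi> i)"
    and ker: "\<And>i n. i \<in> I \<Longrightarrow> n \<in> N \<Longrightarrow> \<phi> i n = 0"
    and dual: "\<And>i j. i \<in> I \<Longrightarrow> j \<in> I \<Longrightarrow> \<phi> i (w j) = (if i = j then 1 else 0)"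
    and gen: "\<And>u. u \<in> U \<Longrightarrow> u - (\<Sum>i\<in>I. csmult (\<phi> i u) (w i)) \<in> N"
    and f: "clinear f" and fU: "\<And>u. u \<in> U \<Longrightarrow> f u \<in> U" and fN: "\<And>n. n \<in> N \<Longrightarrow> f n \<in> N"
  shows "quotient_trace U N f = (\<Sum>i\<in>I. \<phi> i (f (w i)))"
proof -
  \<comment> \<open>\<open>quotient_basis\<close> speaks of a set of vectors, so the family has to
    be injective; \<open>w i = w j\<close> for different indices would give \<open>1 = 0\<close> by
    duality.\<close>
  have inj: "inj_on w I"
    using dual by (intro inj_onI) (metis zero_neq_one)
  have "quotient_basis U N (w ` I)"
    unfolding quotient_basis_def
  proof (intro conjI ballI)
    fix u assume u: "u \<in> U"
    let ?c = "\<lambda>b. if b \<in> w ` I then \<phi> (inv_into I w b) u else 0"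
    show "\<exists>!c. (\<forall>b. b \<notin> w ` I \<longrightarrow> c b = 0) \<and> u - (\<Sum>b\<in>w ` I. csmult (c b) b) \<in> N"
    proof (rule ex1I[of _ ?c])
      show "(\<forall>b. b \<notin> w ` I \<longrightarrow> ?c b = 0) \<and> u - (\<Sum>b\<in>w ` I. csmult (?c b) b) \<in> N"
        using gen[OF u] by (simp add: sum.reindex[OF inj] inv_into_f_f[OF inj])
    next
      fix c assume c: "(\<forall>b. b \<notin> w ` I \<longrightarrow> c b = 0) \<and> u - (\<Sum>b\<in>w ` I. csmult (c b) b) \<in> N"
      show "c = ?c"
      proof
        fix b
        show "c b = ?c b"
        proof (cases "b \<in> w ` I")
          case True
          then obtain j where j: "j \<in> I" "b = w j" by auto
          \<comment> \<open>The functional \<open>\<phi> j\<close> kills the error term in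
            \<open>N\<close> and reads off the coefficient of \<open>w j\<close>, which forces
            uniqueness.\<close>
          have "\<phi> j (u - (\<Sum>i\<in>I. csmult (c (w i)) (w i))) = 0"
            using c j by (intro ker) (auto simp: sum.reindex[OF inj])
          then have "\<phi> j u = (\<Sum>i\<in>I. c (w i) * \<phi> j (w i))"
            by (simp add: linear_simps[OF lin[OF j(1)]])
          also have "\<dots> = (\<Sum>i\<in>I. if j = i then c (w i) else 0)"
            using j by (intro sum.cong) (auto simp: dual)
          also have "\<dots> = c (w j)" using I j by simp
          finally show ?thesis using j inv_into_f_f[OF inj] by simp
        qed (use c in auto)
      qed
    qed
  qed (use w I in auto)
  \<comment> \<open>The basis just built only shows that the choice in \<open>quotient_trace\<close>
    succeeds; from here on \<open>B\<close> is the chosen basis, possibly a different one.\<close>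
  then have "quotient_basis U N (SOME B. quotient_basis U N B)" by (rule someI)
  then obtain B where B: "quotient_basis U N B" and B_def: "B = (SOME B. quotient_basis U N B)"
    by blast
  have finB: "finite B" and BU: "B \<subseteq> U" using B unfolding quotient_basis_def by auto
  let ?c = "quotient_coord N B"
  have coord: "?c (f b) b' = (\<Sum>i\<in>I. \<phi> i b * ?c (f (w i)) b')" if b: "b \<in> B" for b b'
  proof -
    have "?c (f b) = (\<lambda>b'. \<Sum>i\<in>I. \<phi> i b * ?c (f (w i)) b')"
    proof (rule quotient_basis_coord(2)[OF B])
      show "f b \<in> U" using b BU fU by auto
      show "(\<Sum>i\<in>I. \<phi> i b * ?c (f (w i)) b') = 0" if "b' \<notin> B" for b'
      proof (rule sum.neutral, safe)
        fix i assume i: "i \<in> I"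
        have "\<exists>!c. (\<forall>b. b \<notin> B \<longrightarrow> c b = 0) \<and> f (w i) - (\<Sum>b\<in>B. csmult (c b) b) \<in> N"
          using B fU[OF w[OF i]] unfolding quotient_basis_def by blast
        from theI'[OF this] show "\<phi> i b * ?c (f (w i)) b' = 0"
          using that unfolding quotient_coord_def by auto
      qed
      have 1: "f (b - (\<Sum>i\<in>I. csmult (\<phi> i b) (w i))) \<in> N"
        using b BU by (intro fN gen) auto
      have 2: "(\<Sum>i\<in>I. csmult (\<phi> i b) (f (w i) - (\<Sum>b'\<in>B. csmult (?c (f (w i)) b') b'))) \<in> N"
        using quotient_basis_coord(1)[OF B fU[OF w]] N
        by (intro cvec.subspace_sum cvec.subspace_scale) auto
      \<comment> \<open>The error of the claimed expansion of \<open>f b\<close> splits into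
        \<open>f\<close> of the error of expanding \<open>b\<close> in the \<open>w i\<close>, and a
        combination of the errors of expanding the \<open>f (w i)\<close> in
        \<open>B\<close>.\<close>
      have "f b - (\<Sum>b'\<in>B. csmult (\<Sum>i\<in>I. \<phi> i b * ?c (f (w i)) b') b') =
        f (b - (\<Sum>i\<in>I. csmult (\<phi> i b) (w i))) +
        (\<Sum>i\<in>I. csmult (\<phi> i b) (f (w i) - (\<Sum>b'\<in>B. csmult (?c (f (w i)) b') b')))"
        by (simp add: linear_simps[OF f] cvec.scale_right_diff_distrib sum_subtractf
            cvec.scale_sum_right cvec.scale_sum_left sum.swap[of _ B I])
      then show "f b - (\<Sum>b'\<in>B. csmult (\<Sum>i\<in>I. \<phi> i b * ?c (f (w i)) b') b') \<in> N"
        using cvec.subspace_add[OF N 1 2] by simp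
    qed
    then show ?thesis by simp
  qed
  have "quotient_trace U N f = (\<Sum>b\<in>B. \<Sum>i\<in>I. \<phi> i b * ?c (f (w i)) b)"
    unfolding quotient_trace_def Let_def B_def[symmetric] by (intro sum.cong) (auto simp: coord)
  also have "\<dots> = (\<Sum>i\<in>I. \<Sum>b\<in>B. ?c (f (w i)) b * \<phi> i b)"
    by (subst sum.swap) (simp add: mult.commute)
  also have "\<dots> = (\<Sum>i\<in>I. \<phi> i (f (w i)))"
  proof (rule sum.cong)
    fix i assume i: "i \<in> I"
    \<comment> \<open>Applying \<open>\<phi> i\<close> to the expansion of \<open>f (w i)\<close> in
      \<open>B\<close> collapses the inner sum.\<close>
    have "\<phi> i (f (w i) - (\<Sum>b\<in>B. csmult (?c (f (w i)) b) b)) = 0"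
      using quotient_basis_coord(1)[OF B fU[OF w[OF i]]] by (rule ker[OF i])
    then show "(\<Sum>b\<in>B. ?c (f (w i)) b * \<phi> i b) = \<phi> i (f (w i))"
      by (simp add: linear_simps[OF lin[OF i]])
  qed simp
  finally show ?thesis .
qed

text \<open>An independent set inside a finitely spanned space is finite. The coordinate functionals
  are extended to the whole ambient space, so that they can be composed with linear maps such as the
  projections to components, whose values need not lie in \<open>V\<close>.\<close>

lemma finite_dim_dual_basis:
  assumes V: "cvec.subspace V" and S: "finite S" "V \<subseteq> cvec.span S"
  obtains B coord where "finite B" "B \<subseteq> V" "\<And>b. cfunctional (coord b)"
    "\<And>b b'. b \<in> B \<Longrightarrow> b' \<in> B \<Longrightarrow> coord b b' = (if b = b' then 1 else 0)"
    "\<And>v. v \<in> V \<Longrightarrow> v = (\<Sum>b\<in>B. csmult (coord b v) b)"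
proof -
  interpret pair: vector_space_pair csmult "(*) :: complex \<Rightarrow> complex \<Rightarrow> complex"
    by unfold_locales (auto simp: algebra_simps)
  obtain B where B: "B \<subseteq> V" "cvec.independent B" "V \<subseteq> cvec.span B"
    using cvec.maximal_independent_subset[of V] by blast
  have finB: "finite B"
    using cvec.independent_span_bound[OF S(1) B(2)] B(1) S(2) by auto
  have "\<exists>g. cfunctional g \<and> (\<forall>x\<in>B. g x = (if b = x then 1 else 0))" for b
    by (rule pair.linear_independent_extend[OF B(2)])
  then obtain coord where c: "\<And>b. cfunctional (coord b)"
    "\<And>b b'. b' \<in> B \<Longrightarrow> coord b b' = (if b = b' then 1 else 0)"
    by metis
  have exp: "v = (\<Sum>b\<in>B. csmult (coord b v) b)" if v: "v \<in> V" for v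
  proof -
    obtain a where a: "v = (\<Sum>b\<in>B. csmult (a b) b)"
      using subsetD[OF B(3) v] unfolding cvec.span_finite[OF finB] by (elim rangeE)
    have "coord b v = a b" if "b \<in> B" for b
    proof -
      have "coord b v = (\<Sum>b'\<in>B. if b = b' then a b' else 0)"
        unfolding a by (simp add: linear_simps[OF c(1)])
          (intro sum.cong, auto simp: c(2))
      then show ?thesis using finB that by simp
    qed
    then show ?thesis using a by simp
  qed
  show ?thesis by (rule that[OF finB B(1) c(1) _ exp]) (simp add: c(2))
qed

section \<open>Induced modules\<close>

lemma tensor_relations_intros:
  fixes M R V ract lact
  defines "N \<equiv> tensor_relations M R V ract lact"
  shows "\<lbrakk>m \<in> M; m' \<in> M; v \<in> V\<rbrakk> \<Longrightarrow> basis_vec (m + m', v) - basis_vec (m, v) - basis_vec (m', v) \<in> N"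
    and "\<lbrakk>m \<in> M; v \<in> V; v' \<in> V\<rbrakk> \<Longrightarrow> basis_vec (m, v + v') - basis_vec (m, v) - basis_vec (m, v') \<in> N"
    and "\<lbrakk>m \<in> M; v \<in> V\<rbrakk> \<Longrightarrow> basis_vec (csmult c m, v) - csmult c (basis_vec (m, v)) \<in> N"
    and "\<lbrakk>m \<in> M; v \<in> V\<rbrakk> \<Longrightarrow> basis_vec (m, csmult c v) - csmult c (basis_vec (m, v)) \<in> N"
    and "\<lbrakk>m \<in> M; r \<in> R; v \<in> V\<rbrakk> \<Longrightarrow> basis_vec (ract m r, v) - basis_vec (m, lact r v) \<in> N"
    and "cvec.subspace N"
  unfolding N_def tensor_relations_def by ((rule cvec.span_base, blast) | rule cvec.subspace_span)+

text \<open>Serves twice: with \<open>S = {0}\<close> it shows that a map vanishes on the relations,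
  and with \<open>S\<close> the relations themselves that an endomorphism descends to the tensor
  product.\<close>

lemma tensor_relations_clinear_image:
  assumes h: "clinear h" and S: "cvec.subspace S"
    and "\<And>m m' v. \<lbrakk>m \<in> M; m' \<in> M; v \<in> V\<rbrakk> \<Longrightarrow>
      h (basis_vec (m + m', v)) - h (basis_vec (m, v)) - h (basis_vec (m', v)) \<in> S"
    and "\<And>m v v'. \<lbrakk>m \<in> M; v \<in> V; v' \<in> V\<rbrakk> \<Longrightarrow>
      h (basis_vec (m, v + v')) - h (basis_vec (m, v)) - h (basis_vec (m, v')) \<in> S"
    and "\<And>c m v. \<lbrakk>m \<in> M; v \<in> V\<rbrakk> \<Longrightarrow>
      h (basis_vec (csmult c m, v)) - csmult c (h (basis_vec (m, v))) \<in> S"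
    and "\<And>c m v. \<lbrakk>m \<in> M; v \<in> V\<rbrakk> \<Longrightarrow>
      h (basis_vec (m, csmult c v)) - csmult c (h (basis_vec (m, v))) \<in> S"
    and "\<And>m r v. \<lbrakk>m \<in> M; r \<in> R; v \<in> V\<rbrakk> \<Longrightarrow>
      h (basis_vec (ract m r, v)) - h (basis_vec (m, lact r v)) \<in> S"
    and n: "n \<in> tensor_relations M R V ract lact"
  shows "h n \<in> S"
proof -
  have "tensor_relations M R V ract lact \<subseteq> {u. h u \<in> S}"
    unfolding tensor_relations_def
    by (rule cvec.span_minimal[OF _ subspace_clinear_vimage[OF h S]])
       (auto simp: linear_simps[OF h] assms(3-7))
  then show ?thesis using n by auto
qed

text \<open>\<open>L\<close> is a right \<open>G\<close>-set with a transversal \<open>rep ` L\<close>, and \<open>l = rep l \<cdot> fac l\<close>. The factor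
  \<open>fac l\<close> needs to be compatible with the right action only as far as it can be seen on \<open>V\<close>.\<close>

locale induced_module =
  fixes L :: "'l set" and G :: "'g set" and V :: "('b \<Rightarrow>\<^sub>0 complex) set"
    and rmul :: "'l \<Rightarrow> 'g \<Rightarrow> 'l" and gact :: "'g \<Rightarrow> ('b \<Rightarrow>\<^sub>0 complex) \<Rightarrow> ('b \<Rightarrow>\<^sub>0 complex)"
    and rep :: "'l \<Rightarrow> 'l" and fac :: "'l \<Rightarrow> 'g"
  assumes finite_reps: "finite (rep ` L)"
    and rep_in: "l \<in> L \<Longrightarrow> rep l \<in> L"
    and fac_in: "l \<in> L \<Longrightarrow> fac l \<in> G"
    and rep_fac: "l \<in> L \<Longrightarrow> rmul (rep l) (fac l) = l"
    and rep_rmul: "l \<in> L \<Longrightarrow> g \<in> G \<Longrightarrow> rep (rmul l g) = rep l"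
    and subspace_V: "cvec.subspace V"
    and finite_dim_V: "\<exists>S. finite S \<and> V \<subseteq> cvec.span S"
    and clinear_gact: "clinear (gact g)"
    and gact_in: "g \<in> G \<Longrightarrow> v \<in> V \<Longrightarrow> gact g v \<in> V"
    and gact_fac_rmul:
      "\<lbrakk>l \<in> L; g \<in> G; v \<in> V\<rbrakk> \<Longrightarrow> gact (fac (rmul l g)) v = gact (fac l) (gact g v)"
    and gact_fac_rep: "\<lbrakk>l \<in> L; v \<in> V\<rbrakk> \<Longrightarrow> gact (fac (rep l)) v = v"
begin

text \<open>\<open>l\<close> arises from \<open>rep l\<close> by right multiplication with
  \<open>fac l\<close>, and \<open>rep\<close> is unchanged by right multiplication.\<close>

lemma rep_rep: "l \<in> L \<Longrightarrow> rep (rep l) = rep l"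
  using rep_rmul[OF rep_in fac_in] rep_fac by metis

definition ract :: "('l \<Rightarrow>\<^sub>0 complex) \<Rightarrow> ('g \<Rightarrow>\<^sub>0 complex) \<Rightarrow> ('l \<Rightarrow>\<^sub>0 complex)" where
  "ract a r = lin_ext (\<lambda>l. lin_ext (\<lambda>g. basis_vec (rmul l g)) r) a"

definition lact :: "('g \<Rightarrow>\<^sub>0 complex) \<Rightarrow> ('b \<Rightarrow>\<^sub>0 complex) \<Rightarrow> ('b \<Rightarrow>\<^sub>0 complex)" where
  "lact r v = lin_ext (\<lambda>g. gact g v) r"

abbreviation "U \<equiv> free_on (free_on L \<times> V)"
abbreviation "N \<equiv> tensor_relations (free_on L) (free_on G) V ract lact"

lemmas N_intros = tensor_relations_intros[where M = "free_on L" and R = "free_on G" and V = V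
    and ract = ract and lact = lact]
lemmas subspace_N = N_intros(6)

text \<open>The component \<open>V\<close> of the induced module at the representative \<open>\<gamma>\<close>: the tensor of
  \<open>\<gamma> \<cdot> g\<close> and \<open>v\<close> is mapped to \<open>g \<cdot> v\<close>.\<close>

definition component :: "'l \<Rightarrow> (('l \<Rightarrow>\<^sub>0 complex) \<times> ('b \<Rightarrow>\<^sub>0 complex) \<Rightarrow>\<^sub>0 complex) \<Rightarrow> ('b \<Rightarrow>\<^sub>0 complex)"
  where
  "component \<gamma> = lin_ext (\<lambda>(a, v). lin_ext (\<lambda>l. if rep l = \<gamma> then gact (fac l) v else 0) a)"

lemma clinear_component: "clinear (component \<gamma>)"
  unfolding component_def by (rule clinear_lin_ext)

lemma component_basis_vec:
  "component \<gamma> (basis_vec (a, v)) = lin_ext (\<lambda>l. if rep l = \<gamma> then gact (fac l) v else 0) a"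
  by (simp add: component_def)

lemma component_N:
  assumes "n \<in> N" shows "component \<gamma> n = 0"
proof -
  note gact = linear_simps[OF clinear_gact]
  let ?Z = "{0} :: ('b \<Rightarrow>\<^sub>0 complex) set"
  have "component \<gamma> n \<in> ?Z"
  proof (rule tensor_relations_clinear_image[OF clinear_component _ _ _ _ _ _ assms])
    show "component \<gamma> (basis_vec (m, v + v')) - component \<gamma> (basis_vec (m, v))
        - component \<gamma> (basis_vec (m, v')) \<in> ?Z" for m v v'
    proof -
      have "(\<lambda>l. if rep l = \<gamma> then gact (fac l) (v + v') else 0) =
        (\<lambda>l. (if rep l = \<gamma> then gact (fac l) v else 0) + (if rep l = \<gamma> then gact (fac l) v' else 0))"
        by (auto simp: gact)
      then show ?thesis by (simp add: component_basis_vec lin_ext_fun_add)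
    qed
    show "component \<gamma> (basis_vec (m, csmult c v)) - csmult c (component \<gamma> (basis_vec (m, v))) \<in> ?Z"
      for c m v
    proof -
      have "(\<lambda>l. if rep l = \<gamma> then gact (fac l) (csmult c v) else 0) =
        (\<lambda>l. csmult c (if rep l = \<gamma> then gact (fac l) v else 0))"
        by (auto simp: gact)
      then show ?thesis by (simp add: component_basis_vec lin_ext_fun_csmult)
    qed
    \<comment> \<open>For the balancing relation, \<open>rep_rmul\<close> keeps the summand and
      \<open>gact_fac_rmul\<close> moves \<open>g\<close> from the left factor of the tensor to the
      right one.\<close>
    show "component \<gamma> (basis_vec (ract m r, v)) - component \<gamma> (basis_vec (m, lact r v)) \<in> ?Z"
      if "m \<in> free_on L" "r \<in> free_on G" "v \<in> V" for m r v
    proof -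
      have "component \<gamma> (basis_vec (ract m r, v)) =
        lin_ext (\<lambda>l. lin_ext (\<lambda>g. if rep (rmul l g) = \<gamma> then gact (fac (rmul l g)) v else 0) r) m"
        by (simp add: component_basis_vec ract_def lin_ext_lin_ext)
      also have "\<dots> = lin_ext (\<lambda>l. lin_ext (\<lambda>g. if rep l = \<gamma> then gact (fac l) (gact g v) else 0) r) m"
        using that by (intro lin_ext_cong) (auto simp: free_on_def rep_rmul gact_fac_rmul subset_iff)
      also have "\<dots> = lin_ext (\<lambda>l. if rep l = \<gamma> then gact (fac l) (lact r v) else 0) m"
        by (intro lin_ext_cong) (simp add: lact_def clinear_lin_ext_compose[OF clinear_gact])
      finally show ?thesis by (simp add: component_basis_vec)
    qed
  qed (simp_all add: component_basis_vec lin_ext_simps)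
  then show ?thesis by simp
qed

text \<open>A generator \<open>basis_vec (a, v)\<close> is formal and depends linearly on
  \<open>v\<close> only modulo \<open>N\<close>.\<close>

lemma basis_vec_sum_right:
  assumes "finite A" "A \<subseteq> V" "a \<in> free_on L"
  shows "basis_vec (a, \<Sum>b\<in>A. csmult (c b) b) - (\<Sum>b\<in>A. csmult (c b) (basis_vec (a, b))) \<in> N"
  using assms(1,2)
proof (induction A rule: finite_induct)
  case empty
  show ?case
    \<comment> \<open>\<open>basis_vec (a, 0)\<close> is a nonzero vector of the free space; the
      scalar 0 in the relation for scalars shows that it lies in \<open>N\<close>.\<close>
    using N_intros(4)[OF assms(3) cvec.subspace_0[OF subspace_V], of 0] by simp
next
  case (insert x A)
  let ?s = "\<Sum>b\<in>A. csmult (c b) b"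
  have V: "csmult (c x) x \<in> V" "?s \<in> V" "x \<in> V"
    using insert by (auto intro!: cvec.subspace_sum cvec.subspace_scale subspace_V)
  have "basis_vec (a, csmult (c x) x + ?s) -
      (csmult (c x) (basis_vec (a, x)) + (\<Sum>b\<in>A. csmult (c b) (basis_vec (a, b)))) =
    (basis_vec (a, csmult (c x) x + ?s) - basis_vec (a, csmult (c x) x) - basis_vec (a, ?s))
    + ((basis_vec (a, csmult (c x) x) - csmult (c x) (basis_vec (a, x))) +
      (basis_vec (a, ?s) - (\<Sum>b\<in>A. csmult (c b) (basis_vec (a, b)))))"
    by simp
  also have "\<dots> \<in> N"
    using insert V by (intro cvec.subspace_add subspace_N N_intros(2,4) assms(3)) auto
  finally show ?case using insert by simp
qed

lemma basis_vec_expand_left: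
  assumes "a \<in> free_on L" "v \<in> V"
  shows "basis_vec (a, v) - lin_ext (\<lambda>l. basis_vec (basis_vec l, v)) a \<in> N"
proof -
  let ?E = "lin_ext (\<lambda>l. basis_vec (basis_vec l, v))"
  \<comment> \<open>Membership of \<open>a\<close> is part of the induction claim because the
    relations are available only for first components in \<open>free_on L\<close>.\<close>
  have "a \<in> free_on L \<and> basis_vec (a, v) - ?E a \<in> N"
    using assms(1)
  proof (induction a rule: free_on_induct)
    case zero
    show ?case
      using N_intros(3)[OF cvec.subspace_0[OF subspace_free_on] assms(2), of 0]
      by (simp add: lin_ext_simps cvec.subspace_0[OF subspace_free_on])
  next
    case (add x y)
    have "basis_vec (x + y, v) - ?E (x + y) =
      (basis_vec (x + y, v) - basis_vec (x, v) - basis_vec (y, v))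
      + ((basis_vec (x, v) - ?E x) + (basis_vec (y, v) - ?E y))"
      by (simp add: lin_ext_simps)
    also have "\<dots> \<in> N"
      using add assms(2) by (intro cvec.subspace_add subspace_N N_intros(1)) auto
    finally show ?case using add by (auto intro: cvec.subspace_add subspace_free_on)
  next
    case (scale c x)
    have "basis_vec (csmult c x, v) - ?E (csmult c x) =
      (basis_vec (csmult c x, v) - csmult c (basis_vec (x, v))) + csmult c (basis_vec (x, v) - ?E x)"
      by (simp add: lin_ext_simps cvec.scale_right_diff_distrib)
    also have "\<dots> \<in> N"
      using scale assms(2)
      by (intro cvec.subspace_add cvec.subspace_scale subspace_N N_intros(3)) auto
    finally show ?case using scale by (auto intro: cvec.subspace_scale subspace_free_on)
  next
    case (basis l)
    then show ?case by (simp add: cvec.subspace_0[OF subspace_N])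
  qed
  then show ?thesis ..
qed

text \<open>Modulo \<open>N\<close> the tensors of representatives with a basis of \<open>V\<close>
  form a basis. The map sends the summand at \<open>\<gamma>\<close> to the summand at
  \<open>rep (D \<gamma>)\<close> or to zero, so only fixed representatives give diagonal blocks,
  and there the map acts as \<open>fac (D \<gamma>)\<close>.\<close>

theorem trace:
  fixes D :: "'l \<Rightarrow> 'l"
  assumes D_in: "\<And>l g. l \<in> L \<Longrightarrow> g \<in> G \<Longrightarrow> D (rmul l g) \<in> L \<longleftrightarrow> D l \<in> L"
    and D_rmul: "\<And>l g. \<lbrakk>l \<in> L; g \<in> G; D l \<in> L\<rbrakk> \<Longrightarrow> D (rmul l g) = rmul (D l) g"
  shows "quotient_trace U N
      (lin_ext (\<lambda>(a, v). basis_vec (lin_ext (\<lambda>l. if D l \<in> L then basis_vec (D l) else 0) a, v))) =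
    (\<Sum>\<gamma> | \<gamma> \<in> rep ` L \<and> D \<gamma> \<in> L \<and> rep (D \<gamma>) = \<gamma>. quotient_trace V {0} (gact (fac (D \<gamma>))))"
    (is "quotient_trace U N ?f = _")
proof -
  obtain S where S: "finite S" "V \<subseteq> cvec.span S" using finite_dim_V by blast
  obtain B coord where B: "finite B" "B \<subseteq> V" and coord: "\<And>b. cfunctional (coord b)"
    and dual: "\<And>b b'. b \<in> B \<Longrightarrow> b' \<in> B \<Longrightarrow> coord b b' = (if b = b' then 1 else 0)"
    and exp: "\<And>v. v \<in> V \<Longrightarrow> v = (\<Sum>b\<in>B. csmult (coord b v) b)"
    by (rule finite_dim_dual_basis[OF subspace_V S]) (erule that, assumption+)
  have traceV: "quotient_trace V {0} (gact g) = (\<Sum>b\<in>B. coord b (gact g b))" if "g \<in> G" for g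
  proof (rule quotient_trace_eq)
    show "gact g n \<in> {0}" if "n \<in> {0}" for n
      using that by (simp add: linear_simps[OF clinear_gact])
    show "v - (\<Sum>b\<in>B. csmult (coord b v) b) \<in> {0}" if "v \<in> V" for v
      using exp[OF that] by simp
  qed (use B coord dual in \<open>auto simp: clinear_gact gact_in that linear_simps[OF coord]\<close>)

  let ?R = "rep ` L"
  have R_in: "\<gamma> \<in> L" "rep \<gamma> = \<gamma>" "\<And>v. v \<in> V \<Longrightarrow> gact (fac \<gamma>) v = v" if "\<gamma> \<in> ?R" for \<gamma>
    using that rep_in rep_rep gact_fac_rep by auto
  let ?La = "lin_ext (\<lambda>l. if D l \<in> L then basis_vec (D l) else 0)"
  have f_basis: "?f (basis_vec (a, v)) = basis_vec (?La a, v)" for a v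
    by simp
  have La_in: "?La a \<in> free_on L" if "a \<in> free_on L" for a
    using that by (rule lin_ext_in_free_on) (auto simp: cvec.subspace_0[OF subspace_free_on])
  \<comment> \<open>This makes the balancing relations stable under the action; where
    \<open>D\<close> leaves \<open>L\<close> both sides are zero, which is the purpose of
    \<open>D_in\<close>.\<close>
  have La_ract: "?La (ract a r) = ract (?La a) r" if "a \<in> free_on L" "r \<in> free_on G" for a r
  proof -
    have "?La (ract a r) =
      lin_ext (\<lambda>l. lin_ext (\<lambda>g. if D (rmul l g) \<in> L then basis_vec (D (rmul l g)) else 0) r) a"
      by (simp add: ract_def lin_ext_lin_ext)
    also have "\<dots> = lin_ext (\<lambda>l. lin_ext (\<lambda>g. if D l \<in> L then basis_vec (rmul (D l) g) else 0) r) a"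
      using that by (intro lin_ext_cong) (auto simp: free_on_def D_in D_rmul subset_iff)
    also have "\<dots> = lin_ext (\<lambda>l. if D l \<in> L then lin_ext (\<lambda>g. basis_vec (rmul (D l) g)) r else 0) a"
      by (intro lin_ext_cong) simp
    also have "\<dots> = ract (?La a) r"
      by (simp add: ract_def lin_ext_lin_ext if_distrib lin_ext_simps cong: if_cong)
    finally show ?thesis .
  qed

  \<comment> \<open>The dual pair for \<open>quotient_trace_eq\<close>: \<open>w\<close> is the
    tensor of a representative with a basis vector, \<open>\<phi>\<close> takes one coordinate of
    one component.\<close>
  define w where "w = (\<lambda>(\<gamma>, b). basis_vec (basis_vec \<gamma> :: 'l \<Rightarrow>\<^sub>0 complex, b :: 'b \<Rightarrow>\<^sub>0 complex))"
  define \<phi> where "\<phi> = (\<lambda>(\<gamma>, b) u. coord b (component \<gamma> u))"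
  have \<phi>: "cfunctional (\<phi> i)" for i
    unfolding \<phi>_def
    by (cases i) (auto intro: clinear_cfunctional_compose[OF coord clinear_component])
  have comp_w: "component \<gamma> (w (\<gamma>', b)) = (if \<gamma>' = \<gamma> then b else 0)" if "\<gamma>' \<in> ?R" "b \<in> V" for \<gamma> \<gamma>' b
    using R_in(2,3)[OF that(1)] that(2) by (auto simp: w_def component_basis_vec)

  have "quotient_trace U N ?f = (\<Sum>i\<in>?R \<times> B. \<phi> i (?f (w i)))"
  proof (rule quotient_trace_eq)
    show "w i \<in> U" if "i \<in> ?R \<times> B" for i
      using that B R_in(1) by (auto simp: w_def)
    show "\<phi> i n = 0" if "n \<in> N" for i n
      using component_N[OF that] by (auto simp: \<phi>_def linear_simps[OF coord] split: prod.split)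
    show "\<phi> i (w j) = (if i = j then 1 else 0)" if "i \<in> ?R \<times> B" "j \<in> ?R \<times> B" for i j
      using that B
      by (cases i; cases j) (auto simp: \<phi>_def comp_w dual linear_simps[OF coord] subset_iff)
    show "?f u \<in> U" if "u \<in> U" for u
      using that by (rule lin_ext_in_free_on) (auto simp: La_in)
    show "?f n \<in> N" if "n \<in> N" for n
    proof (rule tensor_relations_clinear_image[OF clinear_lin_ext subspace_N _ _ _ _ _ that])
      show "?f (basis_vec (m + m', v)) - ?f (basis_vec (m, v)) - ?f (basis_vec (m', v)) \<in> N"
        if "m \<in> free_on L" "m' \<in> free_on L" "v \<in> V" for m m' v
        unfolding f_basis lin_ext_simps(1) using that by (intro N_intros La_in)
      show "?f (basis_vec (m, v + v')) - ?f (basis_vec (m, v)) - ?f (basis_vec (m, v')) \<in> N"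
        if "m \<in> free_on L" "v \<in> V" "v' \<in> V" for m v v'
        unfolding f_basis using that by (intro N_intros La_in)
      show "?f (basis_vec (csmult c m, v)) - csmult c (?f (basis_vec (m, v))) \<in> N"
        if "m \<in> free_on L" "v \<in> V" for c m v
        unfolding f_basis lin_ext_simps(3) using that by (intro N_intros La_in)
      show "?f (basis_vec (m, csmult c v)) - csmult c (?f (basis_vec (m, v))) \<in> N"
        if "m \<in> free_on L" "v \<in> V" for c m v
        unfolding f_basis using that by (intro N_intros La_in)
      show "?f (basis_vec (ract m r, v)) - ?f (basis_vec (m, lact r v)) \<in> N"
        if "m \<in> free_on L" "r \<in> free_on G" "v \<in> V" for m r v
        unfolding f_basis La_ract[OF that(1,2)] using that by (intro N_intros La_in)
    qed
    show "u - (\<Sum>i\<in>?R \<times> B. csmult (\<phi> i u) (w i)) \<in> N" if "u \<in> U" for u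
    proof -
      \<comment> \<open>\<open>E\<close> is the error of the expansion. It is linear and maps
        \<open>N\<close> into itself, so the claim reduces to tensors of a single element of
        \<open>L\<close> with a vector of \<open>V\<close>.\<close>
      define E where "E u = u - (\<Sum>i\<in>?R \<times> B. csmult (\<phi> i u) (w i))" for u
      have E: "clinear E"
        by (rule clinearI)
           (auto simp: E_def linear_simps[OF \<phi>] cvec.scale_left_distrib sum.distrib
             cvec.scale_right_diff_distrib cvec.scale_sum_right)
      have E_N: "E n \<in> N" if "n \<in> N" for n
        using that component_N[OF that]
        by (auto simp: E_def \<phi>_def linear_simps[OF coord] case_prod_beta)
      have E_generator: "E (basis_vec (basis_vec l, v)) \<in> N" if "l \<in> L" "v \<in> V" for l v
      proof -
        let ?v = "gact (fac l) v"
        have v: "?v \<in> V" using that by (intro gact_in fac_in)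
        have "(\<Sum>i\<in>?R \<times> B. csmult (\<phi> i (basis_vec (basis_vec l, v))) (w i)) =
          (\<Sum>\<gamma>\<in>?R. \<Sum>b\<in>B. csmult (if rep l = \<gamma> then coord b ?v else 0) (w (\<gamma>, b)))"
          by (auto simp: sum.cartesian_product \<phi>_def component_basis_vec linear_simps[OF coord]
              intro!: sum.cong)
        also have "\<dots> = (\<Sum>\<gamma>\<in>?R. if rep l = \<gamma> then \<Sum>b\<in>B. csmult (coord b ?v) (w (\<gamma>, b)) else 0)"
          by (intro sum.cong) auto
        also have "\<dots> = (\<Sum>b\<in>B. csmult (coord b ?v) (w (rep l, b)))"
          using finite_reps that by simp
        \<comment> \<open>Write \<open>l\<close> as \<open>rep l\<close> times \<open>fac l\<close>,
          move \<open>fac l\<close> across the tensor by the balancing relation, and expand the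
          resulting vector in \<open>B\<close>.\<close>
        finally have "E (basis_vec (basis_vec l, v)) =
          (basis_vec (ract (basis_vec (rep l)) (basis_vec (fac l)), v)
            - basis_vec (basis_vec (rep l), lact (basis_vec (fac l)) v))
          + (basis_vec (basis_vec (rep l), \<Sum>b\<in>B. csmult (coord b ?v) b)
            - (\<Sum>b\<in>B. csmult (coord b ?v) (basis_vec (basis_vec (rep l), b))))"
          using exp[OF v] that by (simp add: E_def w_def ract_def lact_def rep_fac)
        also have "\<dots> \<in> N"
          using B that rep_in fac_in
          by (intro cvec.subspace_add subspace_N N_intros(5) basis_vec_sum_right) auto
        finally show ?thesis .
      qed

      have *: "E (basis_vec (a, v)) \<in> N" if "a \<in> free_on L" "v \<in> V" for a v
      proof -
        let ?e = "lin_ext (\<lambda>l. basis_vec (basis_vec l, v)) a"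
        have "E (basis_vec (a, v)) = E (basis_vec (a, v) - ?e) + E ?e"
          by (simp add: linear_simps[OF E])
        also have "\<dots> \<in> N"
          unfolding clinear_lin_ext_compose[OF E] using that
          by (intro cvec.subspace_add subspace_N E_N basis_vec_expand_left lin_ext_mem E_generator)
             (auto dest: free_onD)
        finally show ?thesis .
      qed
      have "lin_ext (\<lambda>x. E (basis_vec x)) u \<in> N"
      proof (rule lin_ext_mem[OF subspace_N])
        fix x assume "x \<in> Poly_Mapping.keys u"
        then have "x \<in> free_on L \<times> V" by (rule free_onD[OF \<open>u \<in> U\<close>])
        then show "E (basis_vec x) \<in> N" using * by (cases x) auto
      qed
      then have "E u \<in> N" using clinear_eq_lin_ext[OF E, of u] by simp
      then show ?thesis by (simp add: E_def)
    qed
  qed (use finite_reps B \<phi> in \<open>simp_all add: subspace_N clinear_lin_ext\<close>)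
  also have "\<dots> = (\<Sum>\<gamma>\<in>?R. \<Sum>b\<in>B. \<phi> (\<gamma>, b) (?f (w (\<gamma>, b))))"
    by (simp add: sum.cartesian_product case_prod_beta)
  also have "\<dots> = (\<Sum>\<gamma>\<in>?R. if D \<gamma> \<in> L \<and> rep (D \<gamma>) = \<gamma>
      then quotient_trace V {0} (gact (fac (D \<gamma>))) else 0)"
  proof (rule sum.cong)
    fix \<gamma> assume "\<gamma> \<in> ?R"
    then have "\<gamma> \<in> L" by (rule R_in)
    \<comment> \<open>The functionals indexed by \<open>\<gamma>\<close> see only the part of the
      image that returns to the summand at \<open>\<gamma>\<close>.\<close>
    have "component \<gamma> (?f (w (\<gamma>, b))) =
      (if D \<gamma> \<in> L \<and> rep (D \<gamma>) = \<gamma> then gact (fac (D \<gamma>)) b else 0)" for b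
      by (simp add: w_def component_basis_vec lin_ext_simps)
    then show "(\<Sum>b\<in>B. \<phi> (\<gamma>, b) (?f (w (\<gamma>, b)))) = (if D \<gamma> \<in> L \<and> rep (D \<gamma>) = \<gamma>
      then quotient_trace V {0} (gact (fac (D \<gamma>))) else 0)"
      by (auto simp: \<phi>_def traceV fac_in linear_simps(4)[OF coord])
  qed simp
  also have "\<dots> = (\<Sum>\<gamma> | \<gamma> \<in> ?R \<and> D \<gamma> \<in> L \<and> rep (D \<gamma>) = \<gamma>. quotient_trace V {0} (gact (fac (D \<gamma>))))"
    using finite_reps by (subst sum.inter_filter[symmetric]) simp_all
  finally show ?thesis .
qed

end

section \<open>Uniform block permutations as bijections between set partitions\<close>

text \<open>The bottom partition is the domain and \<open>\<tau>\<close> points upwards: the map of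
  a product is then the map of the upper factor after that of the lower one.\<close>

definition diagram_of :: "nat set set \<Rightarrow> (nat set \<Rightarrow> nat set) \<Rightarrow> diagram" where
  "diagram_of \<pi> \<tau> = (\<lambda>A. Top ` \<tau> A \<union> Bottom ` A) ` \<pi>"

text \<open>The condition on cardinalities is uniformity; \<open>\<tau>\<close> is arbitrary outside
  \<open>\<pi>\<close>.\<close>

definition block_bij :: "nat \<Rightarrow> nat set set \<Rightarrow> (nat set \<Rightarrow> nat set) \<Rightarrow> bool" where
  "block_bij k \<pi> \<tau> \<longleftrightarrow> partition_on {1..k} \<pi> \<and> partition_on {1..k} (\<tau> ` \<pi>) \<and> inj_on \<tau> \<pi> \<and>
     (\<forall>A\<in>\<pi>. card (\<tau> A) = card A)"

text \<open>The extension of a block bijection to unions of blocks; on a coarser partition it is the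
  map of the diagram whose blocks are merged along that partition.\<close>

definition merge :: "nat set set \<Rightarrow> (nat set \<Rightarrow> nat set) \<Rightarrow> nat set \<Rightarrow> nat set" where
  "merge \<rho> \<delta> C = \<Union> (\<delta> ` {B \<in> \<rho>. B \<subseteq> C})"

lemma vimage_Top_Bottom [simp]:
  "Top -` Top ` A = A" "Bottom -` Bottom ` A = A" "Top -` Bottom ` A = {}" "Bottom -` Top ` A = {}"
  by auto

lemma inj_Top_Bottom: "inj_on Top X" "inj_on Bottom X"
  by (simp_all add: inj_on_def)

lemma vertex_set_eq: "Top ` (Top -` X) \<union> Bottom ` (Bottom -` X) = X"
proof -
  have "x \<in> Top ` (Top -` X) \<union> Bottom ` (Bottom -` X)" if "x \<in> X" for x
    using that by (cases x) auto
  then show ?thesis by auto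
qed

lemma partition_on_unique: "\<lbrakk>partition_on X P; A \<in> P; B \<in> P; x \<in> A; x \<in> B\<rbrakk> \<Longrightarrow> A = B"
  unfolding partition_on_def disjoint_def by blast

lemma partition_onI_unique:
  assumes "\<Union> P = X" "\<And>A B x. \<lbrakk>A \<in> P; B \<in> P; x \<in> A; x \<in> B\<rbrakk> \<Longrightarrow> A = B" "{} \<notin> P"
  shows "partition_on X P"
  using assms by (intro partition_onI) (auto simp: disjnt_iff)

lemma partition_on_subset: "partition_on X P \<Longrightarrow> A \<in> P \<Longrightarrow> A \<subseteq> X"
  unfolding partition_on_def by blast

lemma partition_on_obtain:
  assumes "partition_on X P" "x \<in> X" obtains A where "A \<in> P" "x \<in> A"
  using assms unfolding partition_on_def by blast

lemma partition_on_nonempty: "partition_on X P \<Longrightarrow> A \<in> P \<Longrightarrow> \<exists>x. x \<in> A"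
  unfolding partition_on_def by (metis ex_in_conv)

lemma block_bijD:
  assumes "block_bij k \<pi> \<tau>"
  shows "partition_on {1..k} \<pi>" "partition_on {1..k} (\<tau> ` \<pi>)" "inj_on \<tau> \<pi>"
    "\<And>A. A \<in> \<pi> \<Longrightarrow> card (\<tau> A) = card A"
  using assms by (auto simp: block_bij_def)

lemma block_bij_unique:
  "\<lbrakk>block_bij k \<pi> \<tau>; A \<in> \<pi>; B \<in> \<pi>; x \<in> \<tau> A; x \<in> \<tau> B\<rbrakk> \<Longrightarrow> A = B"
  by (meson block_bijD(2,3) inj_onD image_eqI partition_on_unique)

lemma diagram_of_cong: "(\<And>A. A \<in> \<pi> \<Longrightarrow> \<tau> A = \<tau>' A) \<Longrightarrow> diagram_of \<pi> \<tau> = diagram_of \<pi> \<tau>'"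
  by (simp add: diagram_of_def)

lemma ubp_bot_diagram_of [simp]: "ubp_bot (diagram_of \<pi> \<tau>) = \<pi>"
  by (simp add: ubp_bot_def diagram_of_def image_image)

lemma ubp_top_diagram_of [simp]: "ubp_top (diagram_of \<pi> \<tau>) = \<tau> ` \<pi>"
  by (simp add: ubp_top_def diagram_of_def image_image)

lemma block_map_inv_diagram_of [simp]:
  assumes "A \<in> \<pi>" shows "block_map_inv (diagram_of \<pi> \<tau>) A = \<tau> A"
proof -
  have "(THE B. B \<in> diagram_of \<pi> \<tau> \<and> Bottom -` B = A) = Top ` \<tau> A \<union> Bottom ` A"
    using assms by (intro the_equality) (auto simp: diagram_of_def)
  then show ?thesis by (simp add: block_map_inv_def)
qed

lemma diagram_of_eq_iff:
  "diagram_of \<pi> \<tau> = diagram_of \<pi> \<tau>' \<longleftrightarrow> (\<forall>A\<in>\<pi>. \<tau> A = \<tau>' A)"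
  by (metis block_map_inv_diagram_of diagram_of_cong)

lemma diagram_of_in_UBP:
  assumes "block_bij k \<pi> \<tau>" shows "diagram_of \<pi> \<tau> \<in> carrier (UBP k)"
proof -
  note D = block_bijD[OF assms]
  have un: "\<Union> \<pi> = {1..k}" "(\<Union>A\<in>\<pi>. \<tau> A) = {1..k}"
    using D(1,2) by (auto simp: partition_on_def)
  have "partition_on (vertices k) (diagram_of \<pi> \<tau>)"
  proof (rule partition_onI_unique)
    have "\<Union> (diagram_of \<pi> \<tau>) = Top ` (\<Union>A\<in>\<pi>. \<tau> A) \<union> Bottom ` \<Union> \<pi>"
      by (auto simp: diagram_of_def)
    then show "\<Union> (diagram_of \<pi> \<tau>) = vertices k"
      by (simp only: un vertices_def)
    show "{} \<notin> diagram_of \<pi> \<tau>"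
      using D(1) by (auto simp: diagram_of_def partition_on_def)
    show "p = q" if pq: "p \<in> diagram_of \<pi> \<tau>" "q \<in> diagram_of \<pi> \<tau>" "v \<in> p" "v \<in> q" for p q v
    proof -
      obtain A A' where A: "A \<in> \<pi>" "A' \<in> \<pi>"
        and eq: "p = Top ` \<tau> A \<union> Bottom ` A" "q = Top ` \<tau> A' \<union> Bottom ` A'"
        using pq unfolding diagram_of_def by blast
      have "A = A'"
      proof (cases v)
        case (Top i)
        then have "i \<in> \<tau> A" "i \<in> \<tau> A'" using pq eq by auto
        then show ?thesis by (rule block_bij_unique[OF assms A])
      next
        case (Bottom i)
        then have "i \<in> A" "i \<in> A'" using pq eq by auto
        then show ?thesis by (rule partition_on_unique[OF D(1) A])
      qed
      then show ?thesis using eq by simp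
    qed
  qed
  moreover have "card (B \<inter> Top ` {1..k}) = card (B \<inter> Bottom ` {1..k})"
    if B: "B \<in> diagram_of \<pi> \<tau>" for B
  proof -
    obtain A where A: "A \<in> \<pi>" "B = Top ` \<tau> A \<union> Bottom ` A"
      using B by (auto simp: diagram_of_def)
    have "\<tau> A \<subseteq> {1..k}" "A \<subseteq> {1..k}" using A(1) un by auto
    then have "B \<inter> Top ` {1..k} = Top ` \<tau> A" "B \<inter> Bottom ` {1..k} = Bottom ` A"
      using A by auto
    then show ?thesis
      using D(4)[OF A(1)] by (simp add: card_image inj_on_def)
  qed
  ultimately show ?thesis by (simp add: UBP_def uniform_block_perms_def)
qed

text \<open>Converse to \<open>diagram_of_in_UBP\<close>: every element of the monoid is given by a
  block bijection, so that all later computations take place with maps.\<close>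

lemma
  assumes "d \<in> carrier (UBP k)"
  shows block_bij_block_map_inv: "block_bij k (ubp_bot d) (block_map_inv d)"
    and diagram_of_block_map_inv: "diagram_of (ubp_bot d) (block_map_inv d) = d"
    and ubp_top_eq: "ubp_top d = block_map_inv d ` ubp_bot d"
proof -
  have p: "partition_on (vertices k) d"
    and c: "\<And>B. B \<in> d \<Longrightarrow> card (B \<inter> Top ` {1..k}) = card (B \<inter> Bottom ` {1..k})"
    using assms by (auto simp: UBP_def uniform_block_perms_def)
  have card_eq: "card (Top -` B) = card (Bottom -` B)" and fin: "finite (Top -` B)" "finite (Bottom -` B)"
    if B: "B \<in> d" for B
  proof -
    have "B \<subseteq> vertices k" using p B by (rule partition_on_subset)
    then have *: "B \<inter> Top ` {1..k} = Top ` (Top -` B)" "B \<inter> Bottom ` {1..k} = Bottom ` (Bottom -` B)"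
      by (auto simp: vertices_def)
    then show "card (Top -` B) = card (Bottom -` B)"
      using c[OF B] inj_Top_Bottom unfolding * by (simp only: card_image)
    show "finite (Top -` B)" "finite (Bottom -` B)"
      using \<open>B \<subseteq> vertices k\<close>
      by (auto intro!: finite_subset[of _ "{1..k}"] simp: vertices_def)
  qed
  \<comment> \<open>Uniformity forbids blocks inside a single row. Hence a block is determined by
    its bottom part, and the choice in \<open>block_map_inv\<close> is unambiguous.\<close>
  have ne: "Top -` B \<noteq> {}" "Bottom -` B \<noteq> {}" if B: "B \<in> d" for B
  proof -
    obtain x where "x \<in> B" using partition_on_nonempty[OF p B] by blast
    then have "Top -` B \<noteq> {} \<or> Bottom -` B \<noteq> {}" by (cases x) blast+
    then show "Top -` B \<noteq> {}" "Bottom -` B \<noteq> {}"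
      using card_eq[OF B] fin[OF B] by (metis card_0_eq)+
  qed
  have inv: "block_map_inv d (Bottom -` B) = Top -` B" if B: "B \<in> d" for B
  proof -
    have "(THE B'. B' \<in> d \<and> Bottom -` B' = Bottom -` B) = B"
    proof (rule the_equality)
      fix B' assume B': "B' \<in> d \<and> Bottom -` B' = Bottom -` B"
      obtain x where "x \<in> Bottom -` B" using ne[OF B] by blast
      then show "B' = B" using B B' by (intro partition_on_unique[OF p]) auto
    qed (use B in auto)
    then show ?thesis by (simp add: block_map_inv_def)
  qed
  show eq: "diagram_of (ubp_bot d) (block_map_inv d) = d"
    by (simp add: diagram_of_def ubp_bot_def image_image inv vertex_set_eq
        del: image_vimage_eq)
  show top: "ubp_top d = block_map_inv d ` ubp_bot d"
    by (simp add: ubp_top_def ubp_bot_def image_image inv)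
  have un: "\<Union> d = vertices k" using p by (auto simp: partition_on_def)
  show "block_bij k (ubp_bot d) (block_map_inv d)"
    unfolding block_bij_def
  proof (intro conjI ballI)
    show "partition_on {1..k} (ubp_bot d)"
    proof (rule partition_onI_unique)
      have "\<Union> (ubp_bot d) = Bottom -` \<Union> d" by (auto simp: ubp_bot_def)
      then show "\<Union> (ubp_bot d) = {1..k}" unfolding un by (auto simp: vertices_def)
      show "P = Q" if "P \<in> ubp_bot d" "Q \<in> ubp_bot d" "x \<in> P" "x \<in> Q" for P Q x
        using that partition_on_unique[OF p] unfolding ubp_bot_def by blast
      show "{} \<notin> ubp_bot d" using ne by (auto simp: ubp_bot_def)
    qed
    show "partition_on {1..k} (block_map_inv d ` ubp_bot d)"
      unfolding top[symmetric]
    proof (rule partition_onI_unique)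
      have "\<Union> (ubp_top d) = Top -` \<Union> d" by (auto simp: ubp_top_def)
      then show "\<Union> (ubp_top d) = {1..k}" unfolding un by (auto simp: vertices_def)
      show "P = Q" if "P \<in> ubp_top d" "Q \<in> ubp_top d" "x \<in> P" "x \<in> Q" for P Q x
        using that partition_on_unique[OF p] unfolding ubp_top_def by blast
      show "{} \<notin> ubp_top d" using ne by (auto simp: ubp_top_def)
    qed
    show "inj_on (block_map_inv d) (ubp_bot d)"
    proof (rule inj_onI)
      fix P Q assume "P \<in> ubp_bot d" "Q \<in> ubp_bot d" and eq: "block_map_inv d P = block_map_inv d Q"
      then obtain B C where B: "B \<in> d" "P = Bottom -` B" and C: "C \<in> d" "Q = Bottom -` C"
        by (auto simp: ubp_bot_def)
      then have "Top -` B = Top -` C" using eq inv by simp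
      moreover obtain x where "x \<in> Top -` B" using ne[OF B(1)] by blast
      ultimately have "B = C" using B C by (intro partition_on_unique[OF p]) auto
      then show "P = Q" using B C by simp
    qed
    show "card (block_map_inv d A) = card A" if "A \<in> ubp_bot d" for A
      using that inv card_eq by (auto simp: ubp_bot_def)
  qed
qed

lemma block_bij_comp:
  assumes "block_bij k \<gamma> \<sigma>" "block_bij k \<pi> \<tau>" "\<tau> ` \<pi> = \<gamma>"
  shows "block_bij k \<pi> (\<lambda>A. \<sigma> (\<tau> A))"
  using assms comp_inj_on[of \<tau> \<pi> \<sigma>]
  by (auto simp: block_bij_def image_image[of \<sigma> \<tau> \<pi>, symmetric] comp_def)

lemma block_bij_inv_into:
  assumes "block_bij k \<pi> \<tau>"
  shows "block_bij k (\<tau> ` \<pi>) (inv_into \<pi> \<tau>)" "inv_into \<pi> \<tau> ` \<tau> ` \<pi> = \<pi>"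
proof -
  note D = block_bijD[OF assms]
  show *: "inv_into \<pi> \<tau> ` \<tau> ` \<pi> = \<pi>"
    using D(3) by simp
  show "block_bij k (\<tau> ` \<pi>) (inv_into \<pi> \<tau>)"
    unfolding block_bij_def *
    using D by (auto simp: inj_on_inv_into)
qed

section \<open>Extending a block bijection to a coarser partition\<close>

lemma merge_block:
  assumes "partition_on X \<rho>" "C \<in> \<rho>" shows "merge \<rho> \<delta> C = \<delta> C"
proof -
  have "{B \<in> \<rho>. B \<subseteq> C} = {C}"
    using assms partition_on_unique[OF assms(1)] partition_on_nonempty[OF assms(1)] by blast
  then show ?thesis by (simp add: merge_def)
qed

text \<open>A point lies in \<open>\<delta> B\<close> for only one \<open>B\<close>, and a nonempty
  \<open>B\<close> fits into only one block of \<open>\<gamma>\<close>.\<close>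

lemma merge_unique:
  assumes \<delta>: "block_bij k \<rho> \<delta>" and \<gamma>: "partition_on {1..k} \<gamma>" and "C \<in> \<gamma>" "C' \<in> \<gamma>"
    and "x \<in> merge \<rho> \<delta> C" "x \<in> merge \<rho> \<delta> C'"
  shows "C = C'"
proof -
  obtain B B' where B: "B \<in> \<rho>" "B \<subseteq> C" "x \<in> \<delta> B" and B': "B' \<in> \<rho>" "B' \<subseteq> C'" "x \<in> \<delta> B'"
    using assms by (auto simp: merge_def)
  then have "B = B'" using block_bij_unique[OF \<delta>] by blast
  then show ?thesis
    using B B' partition_on_nonempty[OF block_bijD(1)[OF \<delta>]] partition_on_unique[OF \<gamma>] assms(3,4)
    by blast
qed

text \<open>By the refinement, the blocks of \<open>\<rho>\<close> inside \<open>C\<close> partition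
  \<open>C\<close>; their images are disjoint and have the same sizes, so the cardinalities add up.
  This keeps the merged diagram uniform.\<close>

lemma block_bij_merge:
  assumes \<delta>: "block_bij k \<rho> \<delta>" and ref: "refines {1..k} \<rho> \<gamma>"
  shows "block_bij k \<gamma> (merge \<rho> \<delta>)"
proof -
  note D = block_bijD[OF \<delta>]
  have \<gamma>: "partition_on {1..k} \<gamma>" and sub: "\<And>B. B \<in> \<rho> \<Longrightarrow> \<exists>C\<in>\<gamma>. B \<subseteq> C"
    using ref by (auto simp: refines_def)
  have ne: "\<exists>x. x \<in> merge \<rho> \<delta> C" and card_eq: "card (merge \<rho> \<delta> C) = card C" if C: "C \<in> \<gamma>" for C
  proof -
    have p: "partition_on C {B \<in> \<rho>. B \<subseteq> C}" using ref C by (rule refines_obtains_subset)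
    have fin: "finite C" using partition_on_subset[OF \<gamma> C] finite_subset by blast
    have finC: "finite {B \<in> \<rho>. B \<subseteq> C}" using finite_elements[OF fin p] .
    have "card (merge \<rho> \<delta> C) = (\<Sum>B\<in>{B \<in> \<rho>. B \<subseteq> C}. card (\<delta> B))"
      unfolding merge_def
    proof (rule card_UN_disjoint[OF finC])
      show "\<forall>i\<in>{B \<in> \<rho>. B \<subseteq> C}. finite (\<delta> i)"
        using partition_on_subset[OF D(2)] finite_subset[of _ "{1..k}"] by blast
      show "\<forall>i\<in>{B \<in> \<rho>. B \<subseteq> C}. \<forall>j\<in>{B \<in> \<rho>. B \<subseteq> C}. i \<noteq> j \<longrightarrow> \<delta> i \<inter> \<delta> j = {}"
        using block_bij_unique[OF \<delta>] by blast
    qed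
    also have "\<dots> = (\<Sum>B\<in>{B \<in> \<rho>. B \<subseteq> C}. card B)"
      using D(4) by simp
    also have "\<dots> = card C"
      using product_partition[OF p] fin finite_subset by fastforce
    finally show "card (merge \<rho> \<delta> C) = card C" .
    then show "\<exists>x. x \<in> merge \<rho> \<delta> C"
      using partition_on_nonempty[OF \<gamma> C] fin card_gt_0_iff[of C] card_gt_0_iff[of "merge \<rho> \<delta> C"]
      by fastforce
  qed
  have inj: "inj_on (merge \<rho> \<delta>) \<gamma>"
  proof (rule inj_onI)
    fix C C' assume C: "C \<in> \<gamma>" "C' \<in> \<gamma>" "merge \<rho> \<delta> C = merge \<rho> \<delta> C'"
    obtain x where "x \<in> merge \<rho> \<delta> C" using ne[OF C(1)] by blast
    then show "C = C'" using C(3) by (intro merge_unique[OF \<delta> \<gamma> C(1,2)]) auto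
  qed
  have "partition_on {1..k} (merge \<rho> \<delta> ` \<gamma>)"
  proof (rule partition_onI_unique)
    have "\<Union> (merge \<rho> \<delta> ` \<gamma>) = (\<Union>B\<in>{B \<in> \<rho>. \<exists>C\<in>\<gamma>. B \<subseteq> C}. \<delta> B)"
      unfolding merge_def by blast
    also have "{B \<in> \<rho>. \<exists>C\<in>\<gamma>. B \<subseteq> C} = \<rho>"
      using sub by blast
    finally have "\<Union> (merge \<rho> \<delta> ` \<gamma>) = \<Union> (\<delta> ` \<rho>)" .
    then show "\<Union> (merge \<rho> \<delta> ` \<gamma>) = {1..k}" using D(2) by (simp add: partition_on_def)
    show "P = Q" if "P \<in> merge \<rho> \<delta> ` \<gamma>" "Q \<in> merge \<rho> \<delta> ` \<gamma>" "x \<in> P" "x \<in> Q" for P Q x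
      using that merge_unique[OF \<delta> \<gamma>] by blast
    show "{} \<notin> merge \<rho> \<delta> ` \<gamma>" using ne by (metis empty_iff imageE)
  qed
  then show ?thesis using \<gamma> inj card_eq by (simp add: block_bij_def)
qed

section \<open>Components of a stacked diagram\<close>

lemma stacked_edges_upper:
  assumes "B \<in> d" "u \<in> B" "v \<in> B"
  shows "(in_upper_half u, in_upper_half v) \<in> stacked_edges d d'"
  unfolding stacked_edges_def using assms by blast

lemma stacked_edges_lower:
  assumes "B \<in> d'" "u \<in> B" "v \<in> B"
  shows "(in_lower_half u, in_lower_half v) \<in> stacked_edges d d'"
  unfolding stacked_edges_def using assms by blast

lemma diagram_multI:
  assumes "C \<in> Field (stacked_edges d d') // (stacked_edges d d')\<^sup>*" "v \<in> outer_vertex -` C"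
  shows "outer_vertex -` C \<in> diagram_mult d d'"
  unfolding diagram_mult_def
proof (rule DiffI)
  show "outer_vertex -` C \<notin> {{}}" using assms(2) by blast
qed (rule imageI[OF assms(1)])

lemma diagram_of_memI: "A \<in> \<pi> \<Longrightarrow> Top ` \<tau> A \<union> Bottom ` A \<in> diagram_of \<pi> \<tau>"
  by (simp add: diagram_of_def)

text \<open>Under the refinement each block of the upper diagram is attached to only one middle set
  \<open>\<tau> A\<close>. So the components of the stacked graph are the sets \<open>K A\<close>,
  one for each bottom block \<open>A\<close>, with the merged image as upper row.\<close>

lemma diagram_mult_refines:
  assumes \<delta>: "block_bij k \<rho> \<delta>" and \<tau>: "block_bij k \<pi> \<tau>" and ref: "refines {1..k} \<rho> (\<tau> ` \<pi>)"
  shows "diagram_mult (diagram_of \<rho> \<delta>) (diagram_of \<pi> \<tau>) = diagram_of \<pi> (\<lambda>A. merge \<rho> \<delta> (\<tau> A))"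
proof -
  let ?r = "stacked_edges (diagram_of \<rho> \<delta>) (diagram_of \<pi> \<tau>)"
  define K where "K A = Upper ` merge \<rho> \<delta> (\<tau> A) \<union> Middle ` \<tau> A \<union> Lower ` A" for A
  have sub: "\<exists>A\<in>\<pi>. B \<subseteq> \<tau> A" if "B \<in> \<rho>" for B
    using ref that by (auto simp: refines_def)
  have edge: "\<exists>A\<in>\<pi>. x \<in> K A \<and> y \<in> K A" if "(x, y) \<in> ?r" for x y
    using that unfolding stacked_edges_def
  proof (elim UnE)
    assume "(x, y) \<in> {(in_upper_half u, in_upper_half v) | u v. \<exists>B\<in>diagram_of \<rho> \<delta>. u \<in> B \<and> v \<in> B}"
    then obtain u v B where *: "x = in_upper_half u" "y = in_upper_half v" "B \<in> \<rho>"
      "u \<in> Top ` \<delta> B \<union> Bottom ` B" "v \<in> Top ` \<delta> B \<union> Bottom ` B"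
      unfolding diagram_of_def by blast
    obtain A where "A \<in> \<pi>" "B \<subseteq> \<tau> A" using sub[OF *(3)] by blast
    moreover from this * have "x \<in> K A" "y \<in> K A" by (auto simp: K_def merge_def)
    ultimately show ?thesis by blast
  next
    assume "(x, y) \<in> {(in_lower_half u, in_lower_half v) | u v. \<exists>B\<in>diagram_of \<pi> \<tau>. u \<in> B \<and> v \<in> B}"
    then obtain u v A where "x = in_lower_half u" "y = in_lower_half v" "A \<in> \<pi>"
      "u \<in> Top ` \<tau> A \<union> Bottom ` A" "v \<in> Top ` \<tau> A \<union> Bottom ` A"
      unfolding diagram_of_def by blast
    moreover from this have "x \<in> K A" "y \<in> K A" by (auto simp: K_def)
    ultimately show ?thesis by blast
  qed
  have K_unique: "A = A'" if "A \<in> \<pi>" "A' \<in> \<pi>" "x \<in> K A" "x \<in> K A'" for A A' x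
  proof (cases x)
    case (Upper i)
    then have "\<tau> A = \<tau> A'"
      using that by (intro merge_unique[OF \<delta> block_bijD(2)[OF \<tau>], of _ _ i]) (auto simp: K_def)
    then show ?thesis using that block_bijD(3)[OF \<tau>] by (auto dest: inj_onD)
  next
    case (Middle i)
    then show ?thesis using that block_bij_unique[OF \<tau>] by (auto simp: K_def)
  next
    case (Lower i)
    then show ?thesis using that partition_on_unique[OF block_bijD(1)[OF \<tau>]] by (auto simp: K_def)
  qed
  note lower = stacked_edges_lower[OF diagram_of_memI[of _ \<pi> \<tau>], where d = "diagram_of \<rho> \<delta>"]
  note upper = stacked_edges_upper[OF diagram_of_memI[of _ \<rho> \<delta>], where d' = "diagram_of \<pi> \<tau>"]
  \<comment> \<open>Middle vertices in \<open>\<tau> A\<close> are joined by an edge of the lower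
    diagram; an upper vertex first needs an edge inside its own block. With both directions, any two
    vertices of \<open>K A\<close> are linked through \<open>Middle m\<close>.\<close>
  have conn: "(x, Middle m) \<in> ?r\<^sup>* \<and> (Middle m, x) \<in> ?r\<^sup>*"
    if A: "A \<in> \<pi>" and m: "m \<in> \<tau> A" and x: "x \<in> K A" for A m x
  proof (cases x)
    case (Upper i)
    then obtain B where B: "B \<in> \<rho>" "B \<subseteq> \<tau> A" "i \<in> \<delta> B" using x by (auto simp: K_def merge_def)
    obtain b where b: "b \<in> B" using B(1) partition_on_nonempty[OF block_bijD(1)[OF \<delta>]] by blast
    have "(Upper i, Middle b) \<in> ?r" "(Middle b, Upper i) \<in> ?r"
      using upper[of B "Top i" "Bottom b"] upper[of B "Bottom b" "Top i"] B b by auto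
    moreover have "(Middle b, Middle m) \<in> ?r" "(Middle m, Middle b) \<in> ?r"
      using lower[of A "Top b" "Top m"] lower[of A "Top m" "Top b"] A B b m by auto
    ultimately show ?thesis
      unfolding Upper by (meson converse_rtrancl_into_rtrancl r_into_rtrancl)
  next
    case (Middle i)
    then show ?thesis
      using lower[of A "Top i" "Top m"] lower[of A "Top m" "Top i"] A m x by (auto simp: K_def)
  next
    case (Lower i)
    then show ?thesis
      using lower[of A "Bottom i" "Top m"] lower[of A "Top m" "Bottom i"] A m x by (auto simp: K_def)
  qed
  \<comment> \<open>A path cannot leave \<open>K A\<close>, since every edge lies in one of these
    sets and they are disjoint by \<open>K_unique\<close>.\<close>
  have class_eq: "?r\<^sup>* `` {x} = K A" if A: "A \<in> \<pi>" and x: "x \<in> K A" for A x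
  proof
    show "?r\<^sup>* `` {x} \<subseteq> K A"
    proof
      fix y assume "y \<in> ?r\<^sup>* `` {x}"
      then have "(x, y) \<in> ?r\<^sup>*" by simp
      then show "y \<in> K A"
      proof (induction rule: rtrancl_induct)
        case (step y z)
        then show ?case using edge[OF step(2)] K_unique[OF A] by blast
      qed (rule x)
    qed
    obtain m where m: "m \<in> \<tau> A"
      using A partition_on_nonempty[OF block_bijD(2)[OF \<tau>]] by blast
    show "K A \<subseteq> ?r\<^sup>* `` {x}"
      using conn[OF A m x] conn[OF A m] by (blast intro: rtrancl_trans)
  qed
  have field: "Field ?r = \<Union> (K ` \<pi>)"
  proof
    show "Field ?r \<subseteq> \<Union> (K ` \<pi>)" using edge by (fastforce simp: Field_def)
    show "\<Union> (K ` \<pi>) \<subseteq> Field ?r"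
    proof
      fix x assume "x \<in> \<Union> (K ` \<pi>)"
      then obtain A where A: "A \<in> \<pi>" "x \<in> K A" by blast
      then obtain m where m: "m \<in> \<tau> A"
        using partition_on_nonempty[OF block_bijD(2)[OF \<tau>]] by blast
      have "Middle m \<in> Field ?r" using lower[OF A(1), of "Top m" "Top m"] m by (auto simp: Field_def)
      then show "x \<in> Field ?r"
        using conn[OF A(1) m A(2)] by (metis FieldI1 converse_rtranclE)
    qed
  qed
  have "Field ?r // ?r\<^sup>* = K ` \<pi>"
  proof
    show "Field ?r // ?r\<^sup>* \<subseteq> K ` \<pi>"
      unfolding quotient_def field using class_eq by blast
    show "K ` \<pi> \<subseteq> Field ?r // ?r\<^sup>*"
    proof
      fix X assume "X \<in> K ` \<pi>"
      then obtain A where A: "A \<in> \<pi>" "X = K A" by blast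
      then obtain a where "a \<in> A" using partition_on_nonempty[OF block_bijD(1)[OF \<tau>]] by blast
      then have a: "Lower a \<in> K A" by (auto simp: K_def)
      then have "X = ?r\<^sup>* `` {Lower a}" using class_eq[OF A(1)] A by simp
      then show "X \<in> Field ?r // ?r\<^sup>*"
        using a A(1) unfolding field by (auto intro!: quotientI)
    qed
  qed
  moreover have "outer_vertex -` K A = Top ` merge \<rho> \<delta> (\<tau> A) \<union> Bottom ` A" for A
  proof (rule Set.set_eqI)
    fix v show "v \<in> outer_vertex -` K A \<longleftrightarrow> v \<in> Top ` merge \<rho> \<delta> (\<tau> A) \<union> Bottom ` A"
      by (cases v) (auto simp: K_def)
  qed
  ultimately have "diagram_mult (diagram_of \<rho> \<delta>) (diagram_of \<pi> \<tau>) =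
      diagram_of \<pi> (\<lambda>A. merge \<rho> \<delta> (\<tau> A)) - {{}}"
    by (simp add: diagram_mult_def diagram_of_def image_image)
  \<comment> \<open>Every component meets the lower row, so removing the empty set in
    \<open>diagram_mult\<close> has no effect.\<close>
  moreover have "{} \<notin> diagram_of \<pi> (\<lambda>A. merge \<rho> \<delta> (\<tau> A))"
    using block_bijD(1)[OF \<tau>] by (auto simp: diagram_of_def partition_on_def)
  ultimately show ?thesis by simp
qed

text \<open>A block of the upper diagram that met two top blocks of the lower one would join the
  corresponding bottom blocks, and the bottom of the product would no longer be
  \<open>\<pi>\<close>.\<close>

lemma diagram_mult_bot_eq_imp_refines:
  assumes \<delta>: "block_bij k \<rho> \<delta>" and \<tau>: "block_bij k \<pi> \<tau>"
    and bot: "ubp_bot (diagram_mult (diagram_of \<rho> \<delta>) (diagram_of \<pi> \<tau>)) = \<pi>"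
  shows "refines {1..k} \<rho> (\<tau> ` \<pi>)"
proof -
  let ?r = "stacked_edges (diagram_of \<rho> \<delta>) (diagram_of \<pi> \<tau>)"
  have "\<exists>A\<in>\<pi>. B \<subseteq> \<tau> A" if B: "B \<in> \<rho>" for B
  proof -
    obtain x where x: "x \<in> B" using B partition_on_nonempty[OF block_bijD(1)[OF \<delta>]] by blast
    have Bk: "B \<subseteq> {1..k}" using B by (rule partition_on_subset[OF block_bijD(1)[OF \<delta>]])
    have ex: "\<exists>A\<in>\<pi>. y \<in> \<tau> A" if "y \<in> B" for y
      using partition_on_obtain[OF block_bijD(2)[OF \<tau>], of y] Bk that by blast
    then obtain A where A: "A \<in> \<pi>" "x \<in> \<tau> A" using x by blast
    have "y \<in> \<tau> A" if y: "y \<in> B" for y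
    proof -
      obtain A' where A': "A' \<in> \<pi>" "y \<in> \<tau> A'" using ex[OF y] by blast
      \<comment> \<open>The path from \<open>p\<close> through \<open>x\<close> and \<open>y\<close>
        to \<open>q\<close> puts \<open>p\<close> and \<open>q\<close> into one bottom block of the
        product. That block belongs to \<open>\<pi>\<close>, so it equals both \<open>A\<close> and
        \<open>A'\<close>.\<close>
      obtain p q where p: "p \<in> A" and q: "q \<in> A'"
        using A A' partition_on_nonempty[OF block_bijD(1)[OF \<tau>]] by blast
      note lower = stacked_edges_lower[OF diagram_of_memI[of _ \<pi> \<tau>], where d = "diagram_of \<rho> \<delta>"]
      note upper = stacked_edges_upper[OF diagram_of_memI[of _ \<rho> \<delta>], where d' = "diagram_of \<pi> \<tau>"]
      have 1: "(Lower p, Middle x) \<in> ?r"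
        using lower[of A "Bottom p" "Top x"] A p by auto
      have 2: "(Middle x, Middle y) \<in> ?r"
        using upper[of B "Bottom x" "Bottom y"] B x y by auto
      have 3: "(Middle y, Lower q) \<in> ?r"
        using lower[of A' "Top y" "Bottom q"] A' q by auto
      let ?C = "?r\<^sup>* `` {Lower p}"
      have C: "Lower p \<in> ?C" "Lower q \<in> ?C"
        using 1 2 3 by (auto intro: rtrancl_trans)
      have "?C \<in> Field ?r // ?r\<^sup>*"
        using 1 by (intro quotientI) (auto simp: Field_def)
      moreover have "Bottom p \<in> outer_vertex -` ?C" by simp
      ultimately have "outer_vertex -` ?C \<in> diagram_mult (diagram_of \<rho> \<delta>) (diagram_of \<pi> \<tau>)"
        by (rule diagram_multI)
      then have D: "Bottom -` (outer_vertex -` ?C) \<in> \<pi>"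
        using bot unfolding ubp_bot_def by blast
      have pq: "p \<in> Bottom -` (outer_vertex -` ?C)" "q \<in> Bottom -` (outer_vertex -` ?C)"
        using C by (simp_all only: vimage_eq outer_vertex.simps)
      have "A = A'"
        using partition_on_unique[OF block_bijD(1)[OF \<tau>] D A(1) pq(1) p]
          partition_on_unique[OF block_bijD(1)[OF \<tau>] D A'(1) pq(2) q] by (rule trans[OF sym])
      then show ?thesis using A' by simp
    qed
    then show ?thesis using A(1) by blast
  qed
  then show ?thesis using block_bijD(1)[OF \<delta>] block_bijD(2)[OF \<tau>] by (auto simp: refines_def)
qed

section \<open>The order-preserving bijections and the canonical set partition\<close>

lemma card_filter_type:
  assumes "finite \<pi>"
  shows "card {C \<in> \<pi>. P (card C)} = size (filter_mset P (set_partition_type \<pi>))"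
  using assms
  by (simp add: set_partition_type_def filter_mset_image_mset)

lemma card_eq_size_type: "finite \<pi> \<Longrightarrow> card \<pi> = size (set_partition_type \<pi>)"
  by (simp add: set_partition_type_def)

lemma block_bij_type:
  assumes "block_bij k \<pi> \<tau>"
  shows "set_partition_type (\<tau> ` \<pi>) = set_partition_type \<pi>"
proof -
  have "finite \<pi>" using finite_elements[OF _ block_bijD(1)[OF assms]] by simp
  have "set_partition_type (\<tau> ` \<pi>) = image_mset card (image_mset \<tau> (mset_set \<pi>))"
    by (simp add: set_partition_type_def image_mset_mset_set[OF block_bijD(3)[OF assms]])
  also have "\<dots> = set_partition_type \<pi>"
    unfolding set_partition_type_def multiset.map_comp
    using block_bijD(4)[OF assms] \<open>finite \<pi>\<close> by (intro image_mset_cong) simp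
  finally show ?thesis .
qed

context
  fixes k :: nat and \<pi> :: "nat set set"
  assumes \<pi>: "partition_on {1..k} \<pi>"
begin

lemma finite_partition: "finite \<pi>"
  using finite_elements[OF _ \<pi>] by simp

lemma finite_block: "A \<in> \<pi> \<Longrightarrow> finite A"
  using partition_on_subset[OF \<pi>] finite_subset by blast

lemma graded_last_letter_antisym:
  assumes "A \<in> \<pi>" "B \<in> \<pi>" "graded_last_letter_le A B" "graded_last_letter_le B A"
  shows "A = B"
proof -
  have "Max A = Max B" using assms by (auto simp: graded_last_letter_le_def)
  moreover have "Max A \<in> A" "Max B \<in> B"
    using assms partition_onD3[OF \<pi>] finite_block by (metis Max_in)+
  ultimately show ?thesis using partition_on_unique[OF \<pi> assms(1,2)] by simp
qed

text \<open>The blocks up to \<open>A\<close> are among those up to \<open>B\<close>; equal ranks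
  make the two finite sets equal, so \<open>B\<close> also precedes \<open>A\<close>.\<close>

lemma block_rank_mono:
  assumes "A \<in> \<pi>" "B \<in> \<pi>" "graded_last_letter_le A B" "block_rank \<pi> A = block_rank \<pi> B"
  shows "A = B"
proof -
  have "{C \<in> \<pi>. graded_last_letter_le C A} \<subseteq> {C \<in> \<pi>. graded_last_letter_le C B}"
    using assms(3) by (auto simp: graded_last_letter_le_def)
  then have "{C \<in> \<pi>. graded_last_letter_le C A} = {C \<in> \<pi>. graded_last_letter_le C B}"
    using assms(4) finite_partition by (intro card_subset_eq) (auto simp: block_rank_def)
  moreover have "graded_last_letter_le B B" by (simp add: graded_last_letter_le_def)
  ultimately have "graded_last_letter_le B A" using assms(2) by blast
  then show ?thesis using assms graded_last_letter_antisym by blast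
qed

lemma inj_on_block_rank: "inj_on (block_rank \<pi>) \<pi>"
proof (rule inj_onI)
  fix A B assume *: "A \<in> \<pi>" "B \<in> \<pi>" "block_rank \<pi> A = block_rank \<pi> B"
  have "graded_last_letter_le A B \<or> graded_last_letter_le B A"
    by (auto simp: graded_last_letter_le_def)
  then show "A = B" using block_rank_mono * by metis
qed

lemma block_rank_image: "block_rank \<pi> ` \<pi> = {1..card \<pi>}"
proof (rule card_subset_eq)
  show "block_rank \<pi> ` \<pi> \<subseteq> {1..card \<pi>}"
  proof
    fix r assume "r \<in> block_rank \<pi> ` \<pi>"
    then obtain A where A: "A \<in> \<pi>" "r = card {C \<in> \<pi>. graded_last_letter_le C A}"
      by (auto simp: block_rank_def)
    have "{A} \<subseteq> {C \<in> \<pi>. graded_last_letter_le C A}"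
      using A(1) by (simp add: graded_last_letter_le_def)
    then have "card {A} \<le> r" unfolding A(2) using finite_partition by (intro card_mono) auto
    moreover have "r \<le> card \<pi>" unfolding A(2) using finite_partition by (intro card_mono) auto
    ultimately show "r \<in> {1..card \<pi>}" by simp
  qed
qed (simp_all add: card_image[OF inj_on_block_rank])

text \<open>All blocks of size at most \<open>s\<close> precede \<open>B\<close>, and the rank also
  counts \<open>B\<close> itself, whence the strict inequality.\<close>

lemma block_rank_gt:
  assumes "B \<in> \<pi>" "s < card B" shows "card {C \<in> \<pi>. card C \<le> s} < block_rank \<pi> B"
  unfolding block_rank_def
proof (rule psubset_card_mono)
  show "{C \<in> \<pi>. card C \<le> s} \<subset> {C \<in> \<pi>. graded_last_letter_le C B}"
    using assms by (auto simp: graded_last_letter_le_def)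
qed (simp add: finite_partition)

lemma block_rank_le: "block_rank \<pi> A \<le> card {C \<in> \<pi>. card C \<le> card A}"
  unfolding block_rank_def using finite_partition
  by (intro card_mono) (auto simp: graded_last_letter_le_def)

end

text \<open>The order compares sizes first, so the size of a block can be read off from its rank and
  the numbers of blocks of size at most \<open>s\<close>, and these numbers depend only on the
  type.\<close>

lemma block_rank_eq_imp_card_eq:
  assumes \<gamma>: "partition_on {1..k} \<gamma>" and \<pi>: "partition_on {1..k} \<pi>"
    and type: "set_partition_type \<gamma> = set_partition_type \<pi>"
    and A: "A \<in> \<gamma>" and B: "B \<in> \<pi>" and rank: "block_rank \<gamma> A = block_rank \<pi> B"
  shows "card A = card B"
proof -
  have count: "card {C \<in> \<gamma>. card C \<le> s} = card {C \<in> \<pi>. card C \<le> s}" for s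
    using type card_filter_type[OF finite_partition[OF \<gamma>], of "\<lambda>n. n \<le> s"]
      card_filter_type[OF finite_partition[OF \<pi>], of "\<lambda>n. n \<le> s"] by simp
  have "\<not> card A < card B"
    using block_rank_le[OF \<gamma>, of A] block_rank_gt[OF \<pi> B, of "card A"] rank count[of "card A"]
    by linarith
  moreover have "\<not> card B < card A"
    using block_rank_le[OF \<pi>, of B] block_rank_gt[OF \<gamma> A, of "card B"] rank count[of "card B"]
    by linarith
  ultimately show ?thesis by simp
qed

text \<open>The map of \<open>ell \<gamma> \<pi>\<close> in the direction of
  \<open>diagram_of\<close>, from the bottom \<open>\<pi>\<close> to the top
  \<open>\<gamma>\<close>.\<close>

definition ell_map :: "nat set set \<Rightarrow> nat set set \<Rightarrow> nat set \<Rightarrow> nat set" where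
  "ell_map \<gamma> \<pi> B = inv_into \<gamma> (block_rank \<gamma>) (block_rank \<pi> B)"

lemma
  assumes \<gamma>: "partition_on {1..k} \<gamma>" and \<pi>: "partition_on {1..k} \<pi>"
    and type: "set_partition_type \<gamma> = set_partition_type \<pi>"
  shows block_bij_ell_map: "block_bij k \<pi> (ell_map \<gamma> \<pi>)"
    and ell_map_image: "ell_map \<gamma> \<pi> ` \<pi> = \<gamma>"
    and ell_eq_diagram_of: "ell \<gamma> \<pi> = diagram_of \<pi> (ell_map \<gamma> \<pi>)"
proof -
  have "card \<gamma> = card \<pi>"
    using type finite_partition[OF \<gamma>] finite_partition[OF \<pi>] by (simp add: card_eq_size_type)
  then have ranks: "block_rank \<gamma> ` \<gamma> = block_rank \<pi> ` \<pi>"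
    by (simp add: block_rank_image[OF \<gamma>] block_rank_image[OF \<pi>])
  have ell: "ell_map \<gamma> \<pi> B \<in> \<gamma>" "block_rank \<gamma> (ell_map \<gamma> \<pi> B) = block_rank \<pi> B" if "B \<in> \<pi>" for B
  proof -
    have "block_rank \<pi> B \<in> block_rank \<gamma> ` \<gamma>" using that ranks by simp
    then show "ell_map \<gamma> \<pi> B \<in> \<gamma>" "block_rank \<gamma> (ell_map \<gamma> \<pi> B) = block_rank \<pi> B"
      unfolding ell_map_def by (simp_all add: inv_into_into f_inv_into_f)
  qed
  have ell_unique: "ell_map \<gamma> \<pi> B = A"
    if "A \<in> \<gamma>" "B \<in> \<pi>" "block_rank \<gamma> A = block_rank \<pi> B" for A B
    using that ell inj_on_block_rank[OF \<gamma>] by (metis inj_onD)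
  show image: "ell_map \<gamma> \<pi> ` \<pi> = \<gamma>"
  proof
    show "\<gamma> \<subseteq> ell_map \<gamma> \<pi> ` \<pi>"
    proof
      fix A assume A: "A \<in> \<gamma>"
      then have "block_rank \<gamma> A \<in> block_rank \<pi> ` \<pi>" by (simp flip: ranks)
      then obtain B where "B \<in> \<pi>" "block_rank \<gamma> A = block_rank \<pi> B" by blast
      then show "A \<in> ell_map \<gamma> \<pi> ` \<pi>" using ell_unique[OF A] by blast
    qed
  qed (use ell in blast)
  have "inj_on (ell_map \<gamma> \<pi>) \<pi>"
    using ell(2) inj_on_block_rank[OF \<pi>] by (metis inj_on_def)
  then show "block_bij k \<pi> (ell_map \<gamma> \<pi>)"
    unfolding block_bij_def image
    using \<gamma> \<pi> ell block_rank_eq_imp_card_eq[OF \<gamma> \<pi> type] by blast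
  show "ell \<gamma> \<pi> = diagram_of \<pi> (ell_map \<gamma> \<pi>)"
  proof
    show "ell \<gamma> \<pi> \<subseteq> diagram_of \<pi> (ell_map \<gamma> \<pi>)"
    proof
      fix X assume "X \<in> ell \<gamma> \<pi>"
      then obtain A B where X: "X = Top ` A \<union> Bottom ` B" "A \<in> \<gamma>" "B \<in> \<pi>"
        "block_rank \<gamma> A = block_rank \<pi> B"
        unfolding ell_def by blast
      then have "A = ell_map \<gamma> \<pi> B" using ell_unique by simp
      then show "X \<in> diagram_of \<pi> (ell_map \<gamma> \<pi>)" using X by (simp add: diagram_of_memI)
    qed
    show "diagram_of \<pi> (ell_map \<gamma> \<pi>) \<subseteq> ell \<gamma> \<pi>"
    proof
      fix X assume "X \<in> diagram_of \<pi> (ell_map \<gamma> \<pi>)"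
      then obtain B where "B \<in> \<pi>" "X = Top ` ell_map \<gamma> \<pi> B \<union> Bottom ` B"
        unfolding diagram_of_def by blast
      then show "X \<in> ell \<gamma> \<pi>" unfolding ell_def using ell by blast
    qed
  qed
qed

section \<open>The canonical set partition\<close>

text \<open>Induction from the right end of the list: appending a part leaves the earlier prefix
  sums, and hence the earlier intervals, unchanged.\<close>

lemma partition_on_intervals:
  fixes s :: "nat list"
  assumes "0 \<notin> set s"
  defines "\<pi> \<equiv> {{sum_list (take j s) + 1..sum_list (take (Suc j) s)} | j. j < length s}"
  shows "partition_on {1..sum_list s} \<pi> \<and> set_partition_type \<pi> = mset s"
  using assms(1) unfolding \<pi>_def
proof (induction s rule: rev_induct)
  case Nil
  then show ?case by (simp add: partition_on_def set_partition_type_def)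
next
  case (snoc x s)
  let ?P = "\<lambda>s :: nat list. {{sum_list (take j s) + 1..sum_list (take (Suc j) s)} | j. j < length s}"
  let ?new = "{sum_list s + 1..sum_list s + x}"
  have IH: "partition_on {1..sum_list s} (?P s)" "set_partition_type (?P s) = mset s" and x: "x > 0"
    using snoc by auto
  have eq: "?P (s @ [x]) = insert ?new (?P s)"
  proof -
    have "?P (s @ [x]) = (\<lambda>j. {sum_list (take j (s @ [x])) + 1..sum_list (take (Suc j) (s @ [x]))}) ` {..<Suc (length s)}"
      by (simp only: setcompr_eq_image lessThan_def length_append_singleton)
    also have "\<dots> = insert ?new ((\<lambda>j. {sum_list (take j (s @ [x])) + 1..sum_list (take (Suc j) (s @ [x]))}) ` {..<length s})"
      by (simp add: lessThan_Suc)
    also have "(\<lambda>j. {sum_list (take j (s @ [x])) + 1..sum_list (take (Suc j) (s @ [x]))}) ` {..<length s} = ?P s"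
      unfolding setcompr_eq_image lessThan_def by (rule image_cong) auto
    finally show ?thesis .
  qed
  \<comment> \<open>The set of intervals could swallow a repetition; positivity of \<open>x\<close>
    makes the new interval distinct, so the type counts it.\<close>
  have new: "?new \<notin> ?P s"
  proof
    assume "?new \<in> ?P s"
    then have "?new \<subseteq> {1..sum_list s}" by (rule partition_on_subset[OF IH(1)])
    then show False using x by auto
  qed
  have "partition_on {1..sum_list s + x} (insert ?new (?P s))"
  proof (subst partition_on_insert)
    show "disjnt ?new (\<Union> (?P s))"
      unfolding partition_onD1[OF IH(1), symmetric] by (auto simp: disjnt_iff)
    have "{1..sum_list s + x} - ?new = {1..sum_list s}" by auto
    then show "partition_on ({1..sum_list s + x} - ?new) (?P s) \<and> ?new \<subseteq> {1..sum_list s + x} \<and> ?new \<noteq> {}"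
      using IH x by auto
  qed
  moreover have "set_partition_type (insert ?new (?P s)) = mset (s @ [x])"
    using IH(2) new by (simp add: set_partition_type_def)
  ultimately show ?case unfolding eq by simp
qed

lemma
  assumes "0 \<notin># lam"
  shows partition_on_canonical: "partition_on {1..sum_mset lam} (canonical_set_partition lam)"
    and type_canonical: "set_partition_type (canonical_set_partition lam) = lam"
proof -
  have "sum_list (sorted_list_of_multiset lam) = sum_mset lam"
    by (metis mset_sorted_list_of_multiset sum_mset_sum_list)
  then show "partition_on {1..sum_mset lam} (canonical_set_partition lam)"
    "set_partition_type (canonical_set_partition lam) = lam"
    using partition_on_intervals[of "sorted_list_of_multiset lam"] assms
    by (simp_all add: canonical_set_partition_def Let_def)
qed

lemma vector_type_pos: "0 \<notin># vector_type k lams"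
  unfolding vector_type_def by (auto simp: set_mset_sum)

lemma sum_mset_vector_type:
  assumes "lams \<in> vector_partitions k" shows "sum_mset (vector_type k lams) = k"
proof -
  have "sum_mset (\<Sum>i\<in>I. f i) = (\<Sum>i\<in>I. sum_mset (f i))" for I and f :: "nat \<Rightarrow> nat multiset"
    by (induction I rule: infinite_finite_induct) auto
  then have "sum_mset (vector_type k lams) = (\<Sum>i=1..k. i * sum_mset (lams i))"
    unfolding vector_type_def by (simp add: mult.commute)
  then show ?thesis using assms by (simp add: vector_partitions_def)
qed

section \<open>The action on Specht modules\<close>

lemma act_tabloid_comp: "act_tabloid f (act_tabloid g t) = act_tabloid (f \<circ> g) t"
  by (simp add: act_tabloid_def image_comp)

lemma act_tabloid_cong:
  "(\<And>R x. R \<in> set t \<Longrightarrow> x \<in> R \<Longrightarrow> f x = g x) \<Longrightarrow> act_tabloid f t = act_tabloid g t"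
  by (auto simp: act_tabloid_def cong: image_cong)

lemma act_tabloid_map_set: "act_tabloid f (map set T) = map set (map (map f) T)"
  by (simp add: act_tabloid_def)

lemma tableau_column_map: "tableau_column (map (map f) T) j = f ` tableau_column T j"
proof
  show "tableau_column (map (map f) T) j \<subseteq> f ` tableau_column T j"
  proof
    fix x assume "x \<in> tableau_column (map (map f) T) j"
    then obtain row where "row \<in> set T" "j < length row" "x = map f row ! j"
      by (auto simp: tableau_column_def)
    then show "x \<in> f ` tableau_column T j" by (auto simp: tableau_column_def)
  qed
  show "f ` tableau_column T j \<subseteq> tableau_column (map (map f) T) j"
    by (force simp: tableau_column_def)
qed

lemma tableaux_map:
  assumes "T \<in> tableaux X \<mu>" "inj_on f X" "f ` X = X"
  shows "map (map f) T \<in> tableaux X \<mu>"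
proof -
  have "concat (map (map f) T) = map f (concat T)" by (simp add: map_concat)
  then show ?thesis
    using assms by (simp add: tableaux_def distinct_map comp_def del: set_concat)
qed

lemma column_stabilizer_conj:
  assumes q: "q permutes set (concat T)" and \<sigma>: "\<sigma> \<in> column_stabilizer T"
  shows "q \<circ> \<sigma> \<circ> Hilbert_Choice.inv q \<in> column_stabilizer (map (map q) T)"
proof -
  have X: "set (concat (map (map q) T)) = set (concat T)"
    using permutes_image[OF q] by (simp add: map_concat[symmetric])
  have "q \<circ> \<sigma> \<circ> Hilbert_Choice.inv q permutes set (concat T)"
    using \<sigma> q by (auto simp: column_stabilizer_def intro!: permutes_compose permutes_inv)
  moreover have "(q \<circ> \<sigma> \<circ> Hilbert_Choice.inv q) ` q ` C = q ` \<sigma> ` C" for C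
    using permutes_inverses(2)[OF q] by (simp add: image_image)
  ultimately show ?thesis
    using \<sigma> unfolding column_stabilizer_def X by (simp add: tableau_column_map)
qed

text \<open>Conjugation by \<open>q\<close> is a sign-preserving bijection from the column
  stabilizer of \<open>T\<close> to that of the relabelled tableau; the sum is reindexed along
  it.\<close>

lemma polytabloid_permutes:
  assumes X: "finite X" "set (concat T) = X" and q: "q permutes X"
  shows "lin_ext (\<lambda>t. basis_vec (act_tabloid q t)) (polytabloid T) = polytabloid (map (map q) T)"
proof -
  have X': "set (concat (map (map q) T)) = X"
    using permutes_image[OF q] X(2) by (simp add: map_concat[symmetric])
  have inv: "q \<circ> Hilbert_Choice.inv q = id" "Hilbert_Choice.inv q \<circ> q = id"
    using permutes_inv_o[OF q] by auto
  have inv_inv: "Hilbert_Choice.inv (Hilbert_Choice.inv q) = q" using q by (simp add: permutes_inv_inv)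
  have T: "map (map (Hilbert_Choice.inv q)) (map (map q) T) = T"
    using inv by simp
  have act: "act_tabloid (q \<circ> \<sigma> \<circ> Hilbert_Choice.inv q) (map set (map (map q) T)) =
    act_tabloid q (act_tabloid \<sigma> (map set T))" for \<sigma>
    unfolding act_tabloid_map_set[of q T, symmetric] act_tabloid_comp
    by (simp add: comp_assoc inv)
  have sign: "sign (q \<circ> \<sigma> \<circ> Hilbert_Choice.inv q) = sign \<sigma>" if "\<sigma> \<in> column_stabilizer T" for \<sigma>
  proof -
    have "\<sigma> permutes X" using that X by (simp add: column_stabilizer_def)
    then have "permutation \<sigma>" "permutation q" "permutation (Hilbert_Choice.inv q)"
      using X(1) q permutes_inv[OF q] permutes_imp_permutation by blast+
    moreover from this have "sign q * sign (Hilbert_Choice.inv q) = 1"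
      by (metis inv(1) sign_compose sign_id)
    ultimately show ?thesis by (simp add: sign_compose permutation_compose)
  qed
  have "lin_ext (\<lambda>t. basis_vec (act_tabloid q t)) (polytabloid T) =
    (\<Sum>\<sigma>\<in>column_stabilizer T. csmult (of_int (sign \<sigma>))
      (basis_vec (act_tabloid q (act_tabloid \<sigma> (map set T)))))"
    by (simp add: polytabloid_def lin_ext_simps)
  also have "\<dots> = polytabloid (map (map q) T)"
    unfolding polytabloid_def
  proof (rule sum.reindex_bij_witness[where i = "\<lambda>\<sigma>. Hilbert_Choice.inv q \<circ> \<sigma> \<circ> q" and j = "\<lambda>\<sigma>. q \<circ> \<sigma> \<circ> Hilbert_Choice.inv q"])
    fix \<sigma> assume \<sigma>: "\<sigma> \<in> column_stabilizer T"
    show "q \<circ> \<sigma> \<circ> Hilbert_Choice.inv q \<in> column_stabilizer (map (map q) T)"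
      using column_stabilizer_conj[of q T] q \<sigma> X(2) by simp
    show "csmult (of_int (sign (q \<circ> \<sigma> \<circ> Hilbert_Choice.inv q)))
        (basis_vec (act_tabloid (q \<circ> \<sigma> \<circ> Hilbert_Choice.inv q) (map set (map (map q) T)))) =
      csmult (of_int (sign \<sigma>)) (basis_vec (act_tabloid q (act_tabloid \<sigma> (map set T))))"
      by (simp only: act sign[OF \<sigma>])
  next
    fix \<sigma> assume "\<sigma> \<in> column_stabilizer (map (map q) T)"
    then show "Hilbert_Choice.inv q \<circ> \<sigma> \<circ> q \<in> column_stabilizer T"
      using column_stabilizer_conj[of "Hilbert_Choice.inv q" "map (map q) T" \<sigma>] permutes_inv[OF q] X'
      unfolding T inv_inv by simp
  qed (simp_all add: fun_eq_iff permutes_inverses[OF q])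
  finally show ?thesis .
qed

text \<open>Bijections of \<open>X\<close> onto itself need not be the identity outside \<open>X\<close>, as opposed to
  permutations in the sense of \<open>permutes\<close>.\<close>

lemma polytabloid_relabel:
  assumes X: "finite X" and T: "T \<in> tableaux X \<mu>" and p: "inj_on p X" "p ` X = X"
  shows "lin_ext (\<lambda>t. basis_vec (act_tabloid p t)) (polytabloid T) = polytabloid (map (map p) T)"
proof -
  define q where "q x = (if x \<in> X then p x else x)" for x
  have T': "set (concat T) = X" using T by (simp add: tableaux_def)
  have q: "q permutes X"
    by (rule bij_imp_permutes) (use p in \<open>auto simp: q_def bij_betw_def inj_on_def\<close>)
  have T_q: "map (map p) T = map (map q) T"
    using T' by (auto simp: q_def)
  have "lin_ext (\<lambda>t. basis_vec (act_tabloid p t)) (polytabloid T) =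
    lin_ext (\<lambda>t. basis_vec (act_tabloid q t)) (polytabloid T)"
  proof -
    \<comment> \<open>Column permutations keep the entries inside \<open>X\<close>, where
      \<open>p\<close> and \<open>q\<close> agree.\<close>
    have "act_tabloid p (act_tabloid \<sigma> (map set T)) = act_tabloid q (act_tabloid \<sigma> (map set T))"
      if "\<sigma> \<in> column_stabilizer T" for \<sigma>
    proof -
      have "\<sigma> permutes X" using that T' by (simp add: column_stabilizer_def)
      moreover have "set row \<subseteq> X" if "row \<in> set T" for row using that T' by auto
      ultimately show ?thesis
        by (intro act_tabloid_cong) (auto simp: act_tabloid_def q_def subset_iff dest: permutes_in_image)
    qed
    then show ?thesis
      by (simp add: polytabloid_def lin_ext_simps)
  qed
  then show ?thesis using polytabloid_permutes[OF X T' q] unfolding T_q by (rule trans)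
qed

lemma specht_module_relabel:
  assumes X: "finite X" and p: "inj_on p X" "p ` X = X" and v: "v \<in> specht_module X \<mu>"
  shows "lin_ext (\<lambda>t. basis_vec (act_tabloid p t)) v \<in> specht_module X \<mu>"
proof -
  let ?f = "lin_ext (\<lambda>t. basis_vec (act_tabloid p t))"
  have "cvec.span (polytabloid ` tableaux X \<mu>) \<subseteq> {u. ?f u \<in> specht_module X \<mu>}"
  proof (rule cvec.span_minimal)
    show "polytabloid ` tableaux X \<mu> \<subseteq> {u. ?f u \<in> specht_module X \<mu>}"
      using polytabloid_relabel[OF X _ p] tableaux_map[OF _ p]
      by (auto simp: specht_module_def intro!: cvec.span_base)
    show "cvec.subspace {u. ?f u \<in> specht_module X \<mu>}"
      unfolding specht_module_def
      by (rule subspace_clinear_vimage[OF clinear_lin_ext cvec.subspace_span])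
  qed
  then show ?thesis using v by (auto simp: specht_module_def)
qed

text \<open>Bounds the tabloids that can occur. The bound on the entries makes the action depend
  only on values on \<open>X\<close>; together with the fixed length it gives finite dimension for
  finite \<open>X\<close>.\<close>

lemma specht_module_free_on:
  "specht_module X \<mu> \<subseteq> free_on {t. set t \<subseteq> Pow X \<and> length t = size \<mu>}"
  unfolding specht_module_def
proof (rule cvec.span_minimal[OF _ subspace_free_on])
  show "polytabloid ` tableaux X \<mu> \<subseteq> free_on {t. set t \<subseteq> Pow X \<and> length t = size \<mu>}"
  proof (rule image_subsetI)
    fix T assume T: "T \<in> tableaux X \<mu>"
    have "length T = size \<mu>"
      using T by (metis (mono_tags, lifting) length_map length_rev mem_Collect_eq
          mset_sorted_list_of_multiset size_mset tableaux_def)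
    moreover have "set (act_tabloid \<sigma> (map set T)) \<subseteq> Pow X" if "\<sigma> \<in> column_stabilizer T" for \<sigma>
    proof -
      have "set (concat T) = X" using T by (simp add: tableaux_def)
      then have "\<sigma> permutes X" "\<And>row. row \<in> set T \<Longrightarrow> set row \<subseteq> X"
        using that by (auto simp: column_stabilizer_def)
      then show ?thesis by (auto simp: act_tabloid_def subset_iff dest: permutes_in_image)
    qed
    ultimately show "polytabloid T \<in> free_on {t. set t \<subseteq> Pow X \<and> length t = size \<mu>}"
      unfolding polytabloid_def
      by (intro cvec.subspace_sum cvec.subspace_scale subspace_free_on)
         (simp add: act_tabloid_def)
  qed
qed

section \<open>Tensor products of Specht modules\<close>

text \<open>\<open>pure_tensor\<close> sums over the supports of its factors, so a relabelling must
  neither identify basis vectors nor cancel coefficients.\<close>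

lemma lin_ext_inj_on:
  assumes "inj_on a (Poly_Mapping.keys p)"
  shows "x \<in> Poly_Mapping.keys p \<Longrightarrow>
      Poly_Mapping.lookup (lin_ext (\<lambda>x. basis_vec (a x)) p) (a x) = Poly_Mapping.lookup p x"
    and "Poly_Mapping.keys (lin_ext (\<lambda>x. basis_vec (a x)) p) = a ` Poly_Mapping.keys p"
proof -
  let ?q = "lin_ext (\<lambda>x. basis_vec (a x)) p"
  have lookup: "Poly_Mapping.lookup ?q y = (\<Sum>x\<in>Poly_Mapping.keys p. if a x = y then Poly_Mapping.lookup p x else 0)" for y
    by (auto simp: lin_ext_def lookup_sum_csmult lookup_single when_def intro!: sum.cong)
  show *: "Poly_Mapping.lookup ?q (a x) = Poly_Mapping.lookup p x" if "x \<in> Poly_Mapping.keys p" for x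
  proof -
    have "Poly_Mapping.lookup ?q (a x) =
      (\<Sum>x'\<in>Poly_Mapping.keys p. if x' = x then Poly_Mapping.lookup p x' else 0)"
      unfolding lookup using inj_onD[OF assms] that by (intro sum.cong) auto
    then show ?thesis using that by simp
  qed
  have "y \<notin> Poly_Mapping.keys ?q" if "y \<notin> a ` Poly_Mapping.keys p" for y
    using that lookup[of y] by (auto simp: in_keys_iff intro!: sum.neutral)
  then show "Poly_Mapping.keys ?q = a ` Poly_Mapping.keys p"
    using * by (auto simp: in_keys_iff)
qed

text \<open>The sum is reindexed by the componentwise relabelling, which is injective on the product
  of the supports and maps it onto the product of the new supports.\<close>

lemma pure_tensor_map:
  fixes v :: "nat \<Rightarrow> 'a \<Rightarrow>\<^sub>0 complex" and a :: "'a \<Rightarrow> 'a"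
  assumes inj: "\<And>i. i \<in> {1..k} \<Longrightarrow> inj_on a (Poly_Mapping.keys (v i))"
  shows "lin_ext (\<lambda>t. basis_vec (\<lambda>i\<in>{1..k}. a (t i))) (pure_tensor k v) =
    pure_tensor k (\<lambda>i. lin_ext (\<lambda>x. basis_vec (a x)) (v i))"
proof -
  let ?h = "\<lambda>t. \<lambda>i\<in>{1..k}. a (t i)"
  let ?P = "PiE {1..k} (\<lambda>i. Poly_Mapping.keys (v i))"
  have inj_h: "inj_on ?h ?P"
  proof (rule inj_onI)
    fix s t assume s: "s \<in> ?P" and t: "t \<in> ?P" and eq: "?h s = ?h t"
    show "s = t"
    proof (rule PiE_ext[OF s t])
      fix i assume i: "i \<in> {1..k}"
      then have "a (s i) = a (t i)" using fun_cong[OF eq, of i] by simp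
      then show "s i = t i" using inj_onD[OF inj[OF i]] s t i by (meson PiE_mem)
    qed
  qed
  have image: "?h ` ?P = PiE {1..k} (\<lambda>i. a ` Poly_Mapping.keys (v i))"
  proof
    show "?h ` ?P \<subseteq> PiE {1..k} (\<lambda>i. a ` Poly_Mapping.keys (v i))" by (auto simp: PiE_mem)
    show "PiE {1..k} (\<lambda>i. a ` Poly_Mapping.keys (v i)) \<subseteq> ?h ` ?P"
    proof
      fix t assume t: "t \<in> PiE {1..k} (\<lambda>i. a ` Poly_Mapping.keys (v i))"
      let ?s = "\<lambda>i\<in>{1..k}. inv_into (Poly_Mapping.keys (v i)) a (t i)"
      have "?s \<in> ?P" using t by (auto simp: PiE_mem intro!: inv_into_into)
      moreover have "t = ?h ?s"
      proof (rule PiE_ext[OF t])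
        show "?h ?s \<in> PiE {1..k} (\<lambda>i. a ` Poly_Mapping.keys (v i))"
          using \<open>?s \<in> ?P\<close> by (auto simp: PiE_mem)
        show "t i = ?h ?s i" if "i \<in> {1..k}" for i
          using PiE_mem[OF t that] that by (simp add: f_inv_into_f)
      qed
      ultimately show "t \<in> ?h ` ?P" by (rule rev_image_eqI[of _ _ _ ?h])
    qed
  qed
  have "lin_ext (\<lambda>t. basis_vec (?h t)) (pure_tensor k v) =
    (\<Sum>t\<in>?P. csmult (\<Prod>i=1..k. Poly_Mapping.lookup (v i) (t i)) (basis_vec (?h t)))"
    by (simp add: pure_tensor_def lin_ext_simps)
  also have "\<dots> = (\<Sum>t\<in>?P. csmult (\<Prod>i=1..k.
      Poly_Mapping.lookup (lin_ext (\<lambda>x. basis_vec (a x)) (v i)) (?h t i)) (basis_vec (?h t)))"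
  proof (intro sum.cong refl arg_cong2[where f = csmult] prod.cong)
    fix t i assume t: "t \<in> ?P" and i: "i \<in> {1..k}"
    show "Poly_Mapping.lookup (v i) (t i) =
      Poly_Mapping.lookup (lin_ext (\<lambda>x. basis_vec (a x)) (v i)) (?h t i)"
      using lin_ext_inj_on(1)[OF inj[OF i] PiE_mem[OF t i]] i by simp
  qed
  also have "\<dots> = (\<Sum>t\<in>?h ` ?P. csmult (\<Prod>i=1..k.
      Poly_Mapping.lookup (lin_ext (\<lambda>x. basis_vec (a x)) (v i)) (t i)) (basis_vec t))"
    using inj_h by (simp add: sum.reindex)
  also have "\<dots> = pure_tensor k (\<lambda>i. lin_ext (\<lambda>x. basis_vec (a x)) (v i))"
    unfolding image pure_tensor_def
    using lin_ext_inj_on(2)[OF inj] by (intro sum.cong PiE_cong) auto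
  finally show ?thesis .
qed

definition tensor_tabloids :: "nat \<Rightarrow> (nat \<Rightarrow> nat multiset) \<Rightarrow> (nat \<Rightarrow> nat set set list) set" where
  "tensor_tabloids k lams = PiE {1..k} (\<lambda>i. {t.
     set t \<subseteq> Pow {A \<in> canonical_set_partition (vector_type k lams). card A = i} \<and>
     length t = size (lams i)})"

lemma subspace_specht_tensor: "cvec.subspace (specht_tensor k lams)"
  by (simp add: specht_tensor_def Let_def)

lemma specht_tensor_free_on: "specht_tensor k lams \<subseteq> free_on (tensor_tabloids k lams)"
  unfolding specht_tensor_def Let_def
proof (rule cvec.span_minimal[OF _ subspace_free_on], safe)
  fix v
  assume v: "\<forall>i\<in>{1..k}. v i \<in> specht_module
    {A \<in> canonical_set_partition (vector_type k lams). card A = i} (lams i)"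
  have "PiE {1..k} (\<lambda>i. Poly_Mapping.keys (v i)) \<subseteq> tensor_tabloids k lams"
    unfolding tensor_tabloids_def
  proof (rule PiE_mono)
    fix i assume "i \<in> {1..k}"
    then show "Poly_Mapping.keys (v i) \<subseteq> {t.
      set t \<subseteq> Pow {A \<in> canonical_set_partition (vector_type k lams). card A = i} \<and>
      length t = size (lams i)}"
      using v specht_module_free_on unfolding free_on_def by blast
  qed
  then show "pure_tensor k v \<in> free_on (tensor_tabloids k lams)"
    unfolding pure_tensor_def
    by (intro cvec.subspace_sum cvec.subspace_scale subspace_free_on) auto
qed

lemma finite_tensor_tabloids:
  assumes "finite (canonical_set_partition (vector_type k lams))"
  shows "finite (tensor_tabloids k lams)"
  unfolding tensor_tabloids_def using assms
  by (intro finite_PiE finite_lists_length_eq) auto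

text \<open>The block map preserves sizes, so it permutes the blocks of each size and acts on every
  tensor factor separately.\<close>

lemma group_act_in_specht_tensor:
  assumes \<tau>: "block_bij k (canonical_set_partition (vector_type k lams)) (block_map_inv g)"
    and image: "block_map_inv g ` canonical_set_partition (vector_type k lams) =
      canonical_set_partition (vector_type k lams)"
    and v: "v \<in> specht_tensor k lams"
  shows "group_act k g v \<in> specht_tensor k lams"
proof -
  let ?\<pi> = "canonical_set_partition (vector_type k lams)"
  let ?X = "\<lambda>i. {A \<in> ?\<pi>. card A = i}" and ?p = "block_map_inv g"
  have fin: "finite ?\<pi>" using finite_elements[OF _ block_bijD(1)[OF \<tau>]] by simp
  have inj: "inj_on ?p (?X i)" for i
    using block_bijD(3)[OF \<tau>] by (rule inj_on_subset) auto
  have X: "?p ` ?X i = ?X i" for i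
  proof
    show "?p ` ?X i \<subseteq> ?X i" using image block_bijD(4)[OF \<tau>] by auto
    show "?X i \<subseteq> ?p ` ?X i"
    proof
      fix A assume A: "A \<in> ?X i"
      then obtain B where "B \<in> ?\<pi>" "A = ?p B" using image by blast
      then show "A \<in> ?p ` ?X i" using A block_bijD(4)[OF \<tau>] by auto
    qed
  qed
  have "specht_tensor k lams \<subseteq> {u. group_act k g u \<in> specht_tensor k lams}"
    unfolding specht_tensor_def Let_def
  proof (rule cvec.span_minimal, safe)
    fix v assume v: "\<forall>i\<in>{1..k}. v i \<in> specht_module (?X i) (lams i)"
    let ?w = "\<lambda>i. lin_ext (\<lambda>t. basis_vec (act_tabloid ?p t)) (v i)"
    \<comment> \<open>Injectivity passes from blocks to sets of blocks, and from these to lists of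
      sets.\<close>
    have inj_keys: "inj_on (act_tabloid ?p) (Poly_Mapping.keys (v i))" if "i \<in> {1..k}" for i
    proof -
      have "Poly_Mapping.keys (v i) \<subseteq> lists (Pow (?X i))"
        using v that specht_module_free_on unfolding free_on_def lists_eq_set by blast
      moreover have "inj_on (map ((`) ?p)) (lists (Pow (?X i)))"
        by (rule inj_on_mapI, rule inj_on_subset[OF inj_on_image_Pow[OF inj[of i]]])
           (auto simp: lists_eq_set)
      moreover have "act_tabloid ?p = map ((`) ?p)"
        by (simp add: act_tabloid_def fun_eq_iff)
      ultimately show ?thesis by (metis inj_on_subset)
    qed
    have "group_act k g (pure_tensor k v) = pure_tensor k ?w"
      unfolding group_act_def using inj_keys by (rule pure_tensor_map)
    moreover have "?w i \<in> specht_module (?X i) (lams i)" if "i \<in> {1..k}" for i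
      using fin v that by (intro specht_module_relabel[OF _ inj X]) auto
    ultimately show "group_act k g (pure_tensor k v) \<in> cvec.span {pure_tensor k v |v.
        \<forall>i\<in>{1..k}. v i \<in> specht_module (?X i) (lams i)}"
      by (intro cvec.span_base) blast
  next
    show "cvec.subspace {u. group_act k g u \<in> cvec.span {pure_tensor k v |v.
        \<forall>i\<in>{1..k}. v i \<in> specht_module (?X i) (lams i)}}"
      unfolding group_act_def
      by (rule subspace_clinear_vimage[OF clinear_lin_ext cvec.subspace_span])
  qed
  then show ?thesis using v by blast
qed

text \<open>Agreement on blocks of the canonical partition suffices, since no other sets occur as
  entries of the tabloids in \<open>v\<close>.\<close>

lemma group_act_comp:
  assumes v: "v \<in> specht_tensor k lams"
    and m: "\<And>A. A \<in> canonical_set_partition (vector_type k lams) \<Longrightarrow>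
      block_map_inv m A = block_map_inv g (block_map_inv h A)"
  shows "group_act k m v = group_act k g (group_act k h v)"
proof -
  have "group_act k g (group_act k h v) =
    lin_ext (\<lambda>t. group_act k g (basis_vec (\<lambda>i\<in>{1..k}. act_tabloid (block_map_inv h) (t i)))) v"
    unfolding group_act_def by (rule clinear_lin_ext_compose[OF clinear_lin_ext])
  also have "\<dots> = group_act k m v"
    unfolding group_act_def
  proof (rule lin_ext_cong, unfold lin_ext_basis_vec, rule arg_cong[where f = basis_vec])
    fix t assume "t \<in> Poly_Mapping.keys v"
    then have "t \<in> tensor_tabloids k lams"
      using v specht_tensor_free_on unfolding free_on_def by blast
    then have "R \<subseteq> canonical_set_partition (vector_type k lams)" if "R \<in> set (t i)" "i \<in> {1..k}" for i R
      using that unfolding tensor_tabloids_def by (force dest: PiE_mem)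
    then show "(\<lambda>i\<in>{1..k}. act_tabloid (block_map_inv g) ((\<lambda>i\<in>{1..k}. act_tabloid (block_map_inv h) (t i)) i)) =
      (\<lambda>i\<in>{1..k}. act_tabloid (block_map_inv m) (t i))"
      by (intro restrict_ext) (auto simp: act_tabloid_comp m subset_iff intro!: act_tabloid_cong)
  qed
  finally show ?thesis ..
qed

lemma group_act_id:
  assumes v: "v \<in> specht_tensor k lams"
    and e: "\<And>A. A \<in> canonical_set_partition (vector_type k lams) \<Longrightarrow> block_map_inv e A = A"
  shows "group_act k e v = v"
proof -
  have "group_act k e v = lin_ext basis_vec v"
    unfolding group_act_def
  proof (rule lin_ext_cong, rule arg_cong[where f = basis_vec])
    fix t assume "t \<in> Poly_Mapping.keys v"
    then have t: "t \<in> tensor_tabloids k lams"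
      using v specht_tensor_free_on unfolding free_on_def by blast
    have "act_tabloid (block_map_inv e) (t i) = t i" if "i \<in> {1..k}" for i
    proof -
      have "R \<subseteq> canonical_set_partition (vector_type k lams)" if "R \<in> set (t i)" for R
        using t that \<open>i \<in> {1..k}\<close> unfolding tensor_tabloids_def by (force dest: PiE_mem)
      then have "act_tabloid (block_map_inv e) (t i) = act_tabloid (\<lambda>x. x) (t i)"
        by (intro act_tabloid_cong) (auto simp: e subset_iff)
      then show ?thesis by (simp add: act_tabloid_def)
    qed
    then have "(\<lambda>i\<in>{1..k}. act_tabloid (block_map_inv e) (t i)) = restrict t {1..k}"
      by (intro restrict_ext)
    \<comment> \<open>The tuples indexing the basis are extensional, so the restriction changes
      nothing.\<close>
    also have "\<dots> = t"
      using t unfolding tensor_tabloids_def by (intro restrict_PiE_iff[THEN iffD1] extensional_restrict) (auto simp: PiE_def)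
    finally show "(\<lambda>i\<in>{1..k}. act_tabloid (block_map_inv e) (t i)) = t" .
  qed
  then show ?thesis by simp
qed

section \<open>The character formula\<close>

lemma UBP_mult [simp]: "d \<otimes>\<^bsub>UBP k\<^esub> d' = diagram_mult d d'"
  by (simp add: UBP_def)

lemma diagram_mult_exact:
  assumes \<delta>: "block_bij k \<rho> \<delta>" and \<tau>: "block_bij k \<pi> \<tau>" and eq: "\<tau> ` \<pi> = \<rho>"
  shows "diagram_mult (diagram_of \<rho> \<delta>) (diagram_of \<pi> \<tau>) = diagram_of \<pi> (\<lambda>A. \<delta> (\<tau> A))"
proof -
  have "refines {1..k} \<rho> (\<tau> ` \<pi>)"
    unfolding eq by (rule refines_refl[OF block_bijD(1)[OF \<delta>]])
  then have "diagram_mult (diagram_of \<rho> \<delta>) (diagram_of \<pi> \<tau>) = diagram_of \<pi> (\<lambda>A. merge \<rho> \<delta> (\<tau> A))"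
    by (rule diagram_mult_refines[OF \<delta> \<tau>])
  also have "\<dots> = diagram_of \<pi> (\<lambda>A. \<delta> (\<tau> A))"
    using eq by (intro diagram_of_cong merge_block[OF block_bijD(1)[OF \<delta>]]) blast
  finally show ?thesis .
qed

lemma finite_UBP: "finite (carrier (UBP k))"
proof (rule finite_subset)
  show "carrier (UBP k) \<subseteq> Pow (Pow (vertices k))"
    by (auto simp: UBP_def uniform_block_perms_def partition_on_def)
  show "finite (Pow (Pow (vertices k)))"
    by (simp add: vertices_def)
qed

text \<open>A uniform coarsening is determined by its bottom partition. Each block of
  \<open>\<rho>\<close> inside \<open>C\<close> contributes its image to \<open>\<tau> C\<close>;
  nothing else fits, because the images of all blocks of \<open>\<rho>\<close> cover
  \<open>{1..k}\<close> and the sets \<open>\<tau> C\<close> are disjoint.\<close>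

lemma coarser_eq_diagram_of_iff:
  assumes \<delta>: "block_bij k \<rho> \<delta>" and \<tau>: "block_bij k \<gamma> \<tau>"
  shows "coarser_eq k (diagram_of \<gamma> \<tau>) (diagram_of \<rho> \<delta>) \<longleftrightarrow>
    refines {1..k} \<rho> \<gamma> \<and> (\<forall>C\<in>\<gamma>. \<tau> C = merge \<rho> \<delta> C)"
proof
  have parts: "partition_on (vertices k) (diagram_of \<rho> \<delta>)" "partition_on (vertices k) (diagram_of \<gamma> \<tau>)"
    using diagram_of_in_UBP[OF \<delta>] diagram_of_in_UBP[OF \<tau>]
    by (simp_all add: UBP_def uniform_block_perms_def)
  {
    assume "coarser_eq k (diagram_of \<gamma> \<tau>) (diagram_of \<rho> \<delta>)"
    then have sub: "\<exists>C\<in>\<gamma>. B \<subseteq> C \<and> \<delta> B \<subseteq> \<tau> C" if B: "B \<in> \<rho>" for B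
    proof -
      obtain Y where Y: "Y \<in> diagram_of \<gamma> \<tau>" "Top ` \<delta> B \<union> Bottom ` B \<subseteq> Y"
        using \<open>coarser_eq k _ _\<close> diagram_of_memI[OF B] unfolding coarser_eq_def refines_def by blast
      then obtain C where "C \<in> \<gamma>" "Y = Top ` \<tau> C \<union> Bottom ` C" unfolding diagram_of_def by blast
      then show ?thesis using Y(2) by (intro bexI[of _ C]) auto
    qed
    have "\<tau> C = merge \<rho> \<delta> C" if C: "C \<in> \<gamma>" for C
    proof
      show "merge \<rho> \<delta> C \<subseteq> \<tau> C"
      proof
        fix x assume "x \<in> merge \<rho> \<delta> C"
        then obtain B where B: "B \<in> \<rho>" "B \<subseteq> C" "x \<in> \<delta> B" by (auto simp: merge_def)
        obtain C' where C': "C' \<in> \<gamma>" "B \<subseteq> C'" "\<delta> B \<subseteq> \<tau> C'" using sub[OF B(1)] by blast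
        obtain b where "b \<in> B" using partition_on_nonempty[OF block_bijD(1)[OF \<delta>] B(1)] by blast
        then have "C = C'" using B C' by (intro partition_on_unique[OF block_bijD(1)[OF \<tau>] C]) auto
        then show "x \<in> \<tau> C" using B C' by blast
      qed
      show "\<tau> C \<subseteq> merge \<rho> \<delta> C"
      proof
        fix x assume x: "x \<in> \<tau> C"
        then have "x \<in> {1..k}" using C partition_on_subset[OF block_bijD(2)[OF \<tau>]] by blast
        then obtain B where B: "B \<in> \<rho>" "x \<in> \<delta> B"
          using partition_on_obtain[OF block_bijD(2)[OF \<delta>]] by blast
        obtain C' where C': "C' \<in> \<gamma>" "B \<subseteq> C'" "\<delta> B \<subseteq> \<tau> C'" using sub[OF B(1)] by blast
        then have "C = C'" using x B by (intro block_bij_unique[OF \<tau> C]) auto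
        then show "x \<in> merge \<rho> \<delta> C" using B C' by (auto simp: merge_def)
      qed
    qed
    then show "refines {1..k} \<rho> \<gamma> \<and> (\<forall>C\<in>\<gamma>. \<tau> C = merge \<rho> \<delta> C)"
      using sub block_bijD(1)[OF \<delta>] block_bijD(1)[OF \<tau>] unfolding refines_def by blast
  next
    assume ref: "refines {1..k} \<rho> \<gamma> \<and> (\<forall>C\<in>\<gamma>. \<tau> C = merge \<rho> \<delta> C)"
    have "\<exists>Y\<in>diagram_of \<gamma> \<tau>. X \<subseteq> Y" if X: "X \<in> diagram_of \<rho> \<delta>" for X
    proof -
      obtain B where B: "B \<in> \<rho>" "X = Top ` \<delta> B \<union> Bottom ` B" using X unfolding diagram_of_def by blast
      then obtain C where C: "C \<in> \<gamma>" "B \<subseteq> C" using ref unfolding refines_def by blast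
      then have "\<delta> B \<subseteq> \<tau> C" using ref B by (auto simp: merge_def)
      then show ?thesis using B C by (intro bexI[OF _ diagram_of_memI[OF C(1)]]) auto
    qed
    then show "coarser_eq k (diagram_of \<gamma> \<tau>) (diagram_of \<rho> \<delta>)"
      using parts unfolding coarser_eq_def refines_def by blast
  }
qed

text \<open>The solution \<open>g\<close> of \<open>ell \<gamma> \<pi>\<close> times
  \<open>g\<close> equals \<open>l\<close>, with \<open>\<gamma>\<close> the top of
  \<open>l\<close>, found by inverting \<open>ell_map\<close> on blocks.\<close>

definition ell_factor :: "nat set set \<Rightarrow> diagram \<Rightarrow> diagram" where
  "ell_factor \<pi> l = diagram_of \<pi> (\<lambda>A. inv_into \<pi> (ell_map (ubp_top l) \<pi>) (block_map_inv l A))"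

context
  fixes k :: nat and lams :: "nat \<Rightarrow> nat multiset"
  assumes lams: "lams \<in> vector_partitions k"
begin

private abbreviation (input) "lam \<equiv> vector_type k lams"
private abbreviation (input) "\<pi> \<equiv> canonical_set_partition lam"

lemma partition_pi: "partition_on {1..k} \<pi>"
  using partition_on_canonical[of lam, OF vector_type_pos] sum_mset_vector_type[OF lams] by simp

lemma type_pi: "set_partition_type \<pi> = lam"
  by (rule type_canonical[OF vector_type_pos])

lemma L_classD:
  assumes "l \<in> L_class k lam"
  shows "block_bij k \<pi> (block_map_inv l)" "diagram_of \<pi> (block_map_inv l) = l"
    "ubp_top l = block_map_inv l ` \<pi>" "partition_on {1..k} (ubp_top l)"
    "set_partition_type (ubp_top l) = lam"
proof -
  have *: "l \<in> carrier (UBP k)" "ubp_bot l = \<pi>" using assms by (auto simp: L_class_def)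
  show bij: "block_bij k \<pi> (block_map_inv l)" and "diagram_of \<pi> (block_map_inv l) = l"
    and top: "ubp_top l = block_map_inv l ` \<pi>"
    using block_bij_block_map_inv[OF *(1)] diagram_of_block_map_inv[OF *(1)] ubp_top_eq[OF *(1)]
    unfolding *(2) .
  show "partition_on {1..k} (ubp_top l)" "set_partition_type (ubp_top l) = lam"
    unfolding top by (rule block_bijD(2)[OF bij], simp only: block_bij_type[OF bij] type_pi)
qed

lemma diagram_of_in_L_class: "block_bij k \<pi> \<tau> \<Longrightarrow> diagram_of \<pi> \<tau> \<in> L_class k lam"
  by (simp add: L_class_def diagram_of_in_UBP)

lemma G_groupD:
  assumes "g \<in> G_group k lam"
  shows "block_bij k \<pi> (block_map_inv g)" "diagram_of \<pi> (block_map_inv g) = g"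
    "block_map_inv g ` \<pi> = \<pi>"
proof -
  have "g \<in> L_class k lam" "ubp_top g = \<pi>"
    using assms by (auto simp: L_class_def max_subgroup_def)
  then show "block_bij k \<pi> (block_map_inv g)" "diagram_of \<pi> (block_map_inv g) = g"
    "block_map_inv g ` \<pi> = \<pi>"
    using L_classD by auto
qed

lemma diagram_of_in_G_group: "block_bij k \<pi> \<tau> \<Longrightarrow> \<tau> ` \<pi> = \<pi> \<Longrightarrow> diagram_of \<pi> \<tau> \<in> G_group k lam"
  by (simp add: max_subgroup_def diagram_of_in_UBP)

lemma mult_G_group:
  assumes "l \<in> L_class k lam" "g \<in> G_group k lam"
  shows "diagram_mult l g = diagram_of \<pi> (\<lambda>A. block_map_inv l (block_map_inv g A))"
    and "diagram_mult l g \<in> L_class k lam" and "ubp_top (diagram_mult l g) = ubp_top l"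
proof -
  note l = L_classD[OF assms(1)] and g = G_groupD[OF assms(2)]
  show eq: "diagram_mult l g = diagram_of \<pi> (\<lambda>A. block_map_inv l (block_map_inv g A))"
    using diagram_mult_exact[OF l(1) g(1,3)] unfolding l(2) g(2) .
  show "diagram_mult l g \<in> L_class k lam"
    unfolding eq by (rule diagram_of_in_L_class[OF block_bij_comp[OF l(1) g(1,3)]])
  show "ubp_top (diagram_mult l g) = ubp_top l"
    unfolding eq l(3) using g(3) by (simp flip: image_image)
qed

lemma ell_in_L_class:
  assumes "partition_on {1..k} \<gamma>" "set_partition_type \<gamma> = lam"
  shows "ell \<gamma> \<pi> = diagram_of \<pi> (ell_map \<gamma> \<pi>)" "block_bij k \<pi> (ell_map \<gamma> \<pi>)"
    "ell_map \<gamma> \<pi> ` \<pi> = \<gamma>" "ell \<gamma> \<pi> \<in> L_class k lam" "ubp_top (ell \<gamma> \<pi>) = \<gamma>"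
proof -
  have type: "set_partition_type \<gamma> = set_partition_type \<pi>" using assms(2) type_pi by simp
  note e = ell_eq_diagram_of[OF assms(1) partition_pi type]
    block_bij_ell_map[OF assms(1) partition_pi type] ell_map_image[OF assms(1) partition_pi type]
  then show "ell \<gamma> \<pi> = diagram_of \<pi> (ell_map \<gamma> \<pi>)" "block_bij k \<pi> (ell_map \<gamma> \<pi>)"
    "ell_map \<gamma> \<pi> ` \<pi> = \<gamma>" by -
  show "ell \<gamma> \<pi> \<in> L_class k lam" "ubp_top (ell \<gamma> \<pi>) = \<gamma>"
    unfolding e(1) using e by (simp_all add: diagram_of_in_L_class)
qed

lemma ell_factor_in:
  assumes l: "l \<in> L_class k lam"
  shows "ell_factor \<pi> l \<in> G_group k lam"
    and "A \<in> \<pi> \<Longrightarrow> block_map_inv (ell_factor \<pi> l) A =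
      inv_into \<pi> (ell_map (ubp_top l) \<pi>) (block_map_inv l A)"
proof -
  note e = ell_in_L_class[OF L_classD(4,5)[OF l]]
  note i = block_bij_inv_into[OF e(2), unfolded e(3)]
  show "ell_factor \<pi> l \<in> G_group k lam"
    unfolding ell_factor_def
  proof (rule diagram_of_in_G_group)
    show "block_bij k \<pi> (\<lambda>A. inv_into \<pi> (ell_map (ubp_top l) \<pi>) (block_map_inv l A))"
      using i(1) L_classD(1)[OF l] L_classD(3)[OF l, symmetric] by (rule block_bij_comp)
    show "(\<lambda>A. inv_into \<pi> (ell_map (ubp_top l) \<pi>) (block_map_inv l A)) ` \<pi> = \<pi>"
      using i(2) L_classD(3)[OF l] by (simp flip: image_image)
  qed
  show "A \<in> \<pi> \<Longrightarrow> block_map_inv (ell_factor \<pi> l) A =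
      inv_into \<pi> (ell_map (ubp_top l) \<pi>) (block_map_inv l A)"
    by (simp add: ell_factor_def)
qed

text \<open>Injectivity of \<open>ell_map\<close> allows cancellation on the left. Existence of the
  solution gives the factorization in the induced module, its uniqueness makes \<open>sigma\<close>
  well defined.\<close>

lemma mult_ell_iff:
  assumes l: "l \<in> L_class k lam" and g: "g \<in> G_group k lam"
  shows "diagram_mult (ell (ubp_top l) \<pi>) g = l \<longleftrightarrow> g = ell_factor \<pi> l"
proof -
  let ?e = "ell_map (ubp_top l) \<pi>"
  note e = ell_in_L_class[OF L_classD(4,5)[OF l]]
  have "diagram_mult (ell (ubp_top l) \<pi>) g = diagram_of \<pi> (\<lambda>A. ?e (block_map_inv g A))"
    using diagram_mult_exact[OF e(2) G_groupD(1,3)[OF g]] e(1) G_groupD(2)[OF g] by simp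
  then have "diagram_mult (ell (ubp_top l) \<pi>) g = l \<longleftrightarrow>
      (\<forall>A\<in>\<pi>. ?e (block_map_inv g A) = block_map_inv l A)"
    using diagram_of_eq_iff[of \<pi> "\<lambda>A. ?e (block_map_inv g A)" "block_map_inv l"] L_classD(2)[OF l]
    by simp
  also have "\<dots> \<longleftrightarrow> (\<forall>A\<in>\<pi>. block_map_inv g A = inv_into \<pi> ?e (block_map_inv l A))"
  proof (rule ball_cong[OF refl])
    fix A assume "A \<in> \<pi>"
    then have gA: "block_map_inv g A \<in> \<pi>" and "block_map_inv l A \<in> ?e ` \<pi>"
      using G_groupD(3)[OF g] L_classD(3)[OF l] e(3) by auto
    then obtain B where B: "B \<in> \<pi>" "block_map_inv l A = ?e B" by blast
    note inj = block_bijD(3)[OF e(2)]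
    show "?e (block_map_inv g A) = block_map_inv l A \<longleftrightarrow>
        block_map_inv g A = inv_into \<pi> ?e (block_map_inv l A)"
      unfolding B(2) inv_into_f_f[OF inj B(1)] by (rule inj_on_eq_iff[OF inj gA B(1)])
  qed
  also have "\<dots> \<longleftrightarrow> g = ell_factor \<pi> l"
    using diagram_of_eq_iff[of \<pi> "block_map_inv g"] G_groupD(2)[OF g] by (simp add: ell_factor_def)
  finally show ?thesis .
qed

text \<open>Turns the vanishing condition of the action on \<open>L_class\<close> into a condition
  on the top of \<open>l\<close> alone, which right multiplication by the group does not
  change.\<close>

lemma mult_L_class:
  assumes d: "d \<in> carrier (UBP k)" and l: "l \<in> L_class k lam"
  shows "diagram_mult d l \<in> L_class k lam \<longleftrightarrow> refines {1..k} (ubp_bot d) (ubp_top l)"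
    and "refines {1..k} (ubp_bot d) (ubp_top l) \<Longrightarrow> diagram_mult d l =
      diagram_of \<pi> (\<lambda>A. merge (ubp_bot d) (block_map_inv d) (block_map_inv l A))"
proof -
  note l' = L_classD[OF l] and d' = block_bij_block_map_inv[OF d]
  show mult: "diagram_mult d l = diagram_of \<pi> (\<lambda>A. merge (ubp_bot d) (block_map_inv d) (block_map_inv l A))"
    if "refines {1..k} (ubp_bot d) (ubp_top l)"
    using diagram_mult_refines[OF d' l'(1)] that unfolding diagram_of_block_map_inv[OF d] l'(2,3) by blast
  show "diagram_mult d l \<in> L_class k lam \<longleftrightarrow> refines {1..k} (ubp_bot d) (ubp_top l)"
  proof
    assume "diagram_mult d l \<in> L_class k lam"
    then have "ubp_bot (diagram_mult (diagram_of (ubp_bot d) (block_map_inv d)) (diagram_of \<pi> (block_map_inv l))) = \<pi>"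
      unfolding diagram_of_block_map_inv[OF d] l'(2) by (simp add: L_class_def)
    then show "refines {1..k} (ubp_bot d) (ubp_top l)"
      unfolding l'(3) by (rule diagram_mult_bot_eq_imp_refines[OF d' l'(1)])
  next
    assume ref: "refines {1..k} (ubp_bot d) (ubp_top l)"
    show "diagram_mult d l \<in> L_class k lam"
      unfolding mult[OF ref]
      by (intro diagram_of_in_L_class block_bij_comp[OF block_bij_merge[OF d' ref] l'(1) l'(3)[symmetric]])
  qed
qed

interpretation induced: induced_module "L_class k lam" "G_group k lam" "specht_tensor k lams"
  diagram_mult "group_act k" "\<lambda>l. ell (ubp_top l) \<pi>" "ell_factor \<pi>"
proof (rule induced_module.intro)
  show "finite ((\<lambda>l. ell (ubp_top l) \<pi>) ` L_class k lam)"
    using finite_UBP by (intro finite_imageI) (simp add: L_class_def)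
  show "ell (ubp_top l) \<pi> \<in> L_class k lam" if "l \<in> L_class k lam" for l
    using ell_in_L_class(4)[OF L_classD(4,5)[OF that]] .
  show "ell_factor \<pi> l \<in> G_group k lam" if "l \<in> L_class k lam" for l
    using ell_factor_in(1)[OF that] .
  show "diagram_mult (ell (ubp_top l) \<pi>) (ell_factor \<pi> l) = l" if "l \<in> L_class k lam" for l
    using mult_ell_iff[OF that ell_factor_in(1)[OF that]] by simp
  show "ell (ubp_top (diagram_mult l g)) \<pi> = ell (ubp_top l) \<pi>"
    if "l \<in> L_class k lam" "g \<in> G_group k lam" for l g
    using mult_G_group(3)[OF that] by simp
  show "cvec.subspace (specht_tensor k lams)"
    by (rule subspace_specht_tensor)
  show "\<exists>S. finite S \<and> specht_tensor k lams \<subseteq> cvec.span S"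
    using specht_tensor_free_on[of k lams] finite_tensor_tabloids[OF finite_partition[OF partition_pi]]
    unfolding free_on_eq_span by blast
  show "clinear (group_act k g)" for g
    unfolding group_act_def by (rule clinear_lin_ext)
  show "group_act k g v \<in> specht_tensor k lams"
    if "g \<in> G_group k lam" "v \<in> specht_tensor k lams" for g v
    using group_act_in_specht_tensor[OF G_groupD(1,3)[OF that(1)] that(2)] .
  \<comment> \<open>The product of \<open>l\<close> with \<open>g\<close> has the same top as
    \<open>l\<close>, so both factors are obtained by inverting the same
    \<open>ell_map\<close>.\<close>
  show "group_act k (ell_factor \<pi> (diagram_mult l g)) v =
      group_act k (ell_factor \<pi> l) (group_act k g v)"
    if "l \<in> L_class k lam" "g \<in> G_group k lam" "v \<in> specht_tensor k lams" for l g v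
  proof (rule group_act_comp[OF that(3)])
    fix A assume "A \<in> \<pi>"
    then have "block_map_inv g A \<in> \<pi>" using G_groupD(3)[OF that(2)] by blast
    then show "block_map_inv (ell_factor \<pi> (diagram_mult l g)) A =
        block_map_inv (ell_factor \<pi> l) (block_map_inv g A)"
      using \<open>A \<in> \<pi>\<close> mult_G_group[OF that(1,2)]
      by (simp add: ell_factor_in(2) that(1))
  qed
  show "group_act k (ell_factor \<pi> (ell (ubp_top l) \<pi>)) v = v"
    if "l \<in> L_class k lam" "v \<in> specht_tensor k lams" for l v
  proof (rule group_act_id[OF that(2)])
    fix A assume A: "A \<in> \<pi>"
    note e = ell_in_L_class[OF L_classD(4,5)[OF that(1)]]
    have "block_map_inv (ell (ubp_top l) \<pi>) A = ell_map (ubp_top l) \<pi> A"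
      unfolding e(1) using A by simp
    then show "block_map_inv (ell_factor \<pi> (ell (ubp_top l) \<pi>)) A = A"
      using A e block_bijD(3)[OF e(2)] by (simp add: ell_factor_in(2) inv_into_f_f)
  qed
qed

lemma monoid_character_eq_sum_reps:
  assumes d: "d \<in> carrier (UBP k)"
  defines "R \<equiv> (\<lambda>l. ell (ubp_top l) \<pi>) ` L_class k lam"
  shows "monoid_character k lams d =
    (\<Sum>r | r \<in> R \<and> diagram_mult d r \<in> L_class k lam \<and> ell (ubp_top (diagram_mult d r)) \<pi> = r.
      group_character k lams (ell_factor \<pi> (diagram_mult d r)))"
proof -
  have ract: "induced.ract = L_right_act k"
    by (intro ext) (simp add: induced.ract_def L_right_act_def)
  have lact: "induced.lact = group_algebra_act k"
    by (intro ext) (simp add: induced.lact_def group_algebra_act_def)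
  have act: "induced_act k lams d = lin_ext (\<lambda>(a, v). basis_vec
      (lin_ext (\<lambda>l. if diagram_mult d l \<in> L_class k lam then basis_vec (diagram_mult d l) else 0) a, v))"
    unfolding induced_act_def L_act_def UBP_mult ..
  have D: "diagram_mult d (diagram_mult l g) \<in> L_class k lam \<longleftrightarrow> diagram_mult d l \<in> L_class k lam"
    if "l \<in> L_class k lam" "g \<in> G_group k lam" for l g
    using mult_L_class(1)[OF d mult_G_group(2)[OF that]] mult_L_class(1)[OF d that(1)]
      mult_G_group(3)[OF that] by simp
  \<comment> \<open>Associativity is read off from the explicit maps: both sides are given by the
    merged map of \<open>d\<close> after that of \<open>l\<close> after that of
    \<open>g\<close>.\<close>
  have "diagram_mult d (diagram_mult l g) = diagram_mult (diagram_mult d l) g"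
    if l: "l \<in> L_class k lam" and g: "g \<in> G_group k lam" and dl: "diagram_mult d l \<in> L_class k lam" for l g
  proof -
    note lg = mult_G_group[OF l g]
    have ref: "refines {1..k} (ubp_bot d) (ubp_top l)" using dl mult_L_class(1)[OF d l] by simp
    have "block_map_inv g A \<in> \<pi>" if "A \<in> \<pi>" for A using that G_groupD(3)[OF g] by blast
    then show ?thesis
      using mult_L_class(2)[OF d lg(2)] ref lg mult_G_group(1)[OF dl g] mult_L_class(2)[OF d l ref]
      by (auto intro!: diagram_of_cong)
  qed
  from induced.trace[of "diagram_mult d", OF D this] show ?thesis
    unfolding monoid_character_def induced_gens_def induced_rels_def act ract lact R_def
      group_character_def by simp
qed

section \<open>Coarsenings and their group elements\<close>

text \<open>A coarsening is the merged map of \<open>d\<close> on its bottom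
  \<open>\<gamma>\<close>, so equality of top and bottom becomes invariance of
  \<open>\<gamma>\<close> under that map.\<close>

lemma coarsenings_iff:
  assumes d: "d \<in> carrier (UBP k)"
  shows "c \<in> coarsenings k d lam \<longleftrightarrow>
    (\<exists>\<gamma>. c = diagram_of \<gamma> (merge (ubp_bot d) (block_map_inv d)) \<and> refines {1..k} (ubp_bot d) \<gamma> \<and>
      merge (ubp_bot d) (block_map_inv d) ` \<gamma> = \<gamma> \<and> set_partition_type \<gamma> = lam)"
proof -
  let ?m = "merge (ubp_bot d) (block_map_inv d)"
  note d' = block_bij_block_map_inv[OF d] diagram_of_block_map_inv[OF d]
  show ?thesis
  proof
    assume "c \<in> coarsenings k d lam"
    then have c: "c \<in> carrier (UBP k)" "coarser_eq k c d" "ubp_top c = ubp_bot c"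
      "set_partition_type (ubp_top c) = lam"
      by (auto simp: coarsenings_def)
    note c' = block_bij_block_map_inv[OF c(1)] diagram_of_block_map_inv[OF c(1)]
    have *: "refines {1..k} (ubp_bot d) (ubp_bot c)" "\<And>C. C \<in> ubp_bot c \<Longrightarrow> block_map_inv c C = ?m C"
      using coarser_eq_diagram_of_iff[OF d'(1) c'(1)] c(2) unfolding c'(2) d'(2) by blast+
    have "c = diagram_of (ubp_bot c) ?m"
      using c'(2) diagram_of_cong[of "ubp_bot c" "block_map_inv c" ?m] *(2) by simp
    moreover have "?m ` ubp_bot c = ubp_bot c"
      using ubp_top_eq[OF c(1)] c(3) *(2) by simp
    ultimately show "\<exists>\<gamma>. c = diagram_of \<gamma> ?m \<and> refines {1..k} (ubp_bot d) \<gamma> \<and> ?m ` \<gamma> = \<gamma> \<and>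
        set_partition_type \<gamma> = lam"
      using *(1) c(3,4) by metis
  next
    assume "\<exists>\<gamma>. c = diagram_of \<gamma> ?m \<and> refines {1..k} (ubp_bot d) \<gamma> \<and> ?m ` \<gamma> = \<gamma> \<and>
        set_partition_type \<gamma> = lam"
    then obtain \<gamma> where \<gamma>: "c = diagram_of \<gamma> ?m" "refines {1..k} (ubp_bot d) \<gamma>" "?m ` \<gamma> = \<gamma>"
      "set_partition_type \<gamma> = lam"
      by blast
    have bij: "block_bij k \<gamma> ?m" by (rule block_bij_merge[OF d'(1) \<gamma>(2)])
    have "coarser_eq k c d"
      using coarser_eq_diagram_of_iff[OF d'(1) bij] \<gamma>(1,2) unfolding d'(2) by simp
    then show "c \<in> coarsenings k d lam"
      using \<gamma> diagram_of_in_UBP[OF bij] by (simp add: coarsenings_def)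
  qed
qed

text \<open>Multiplication by \<open>ell \<gamma> \<pi>\<close> merges the blocks of
  \<open>d\<close> along \<open>\<gamma>\<close>, and \<open>c\<close> is already merged, so
  \<open>c\<close> and \<open>d\<close> give the same product. Solving for the group element
  identifies \<open>sigma\<close> with the factor that occurs in the trace.\<close>

lemma coarsening_sigma:
  assumes d: "d \<in> carrier (UBP k)" and c: "c \<in> coarsenings k d lam"
  defines "\<gamma> \<equiv> ubp_top c"
  shows "refines {1..k} (ubp_bot d) \<gamma>" "set_partition_type \<gamma> = lam"
    and "c = diagram_of \<gamma> (merge (ubp_bot d) (block_map_inv d))"
    and "ubp_top (diagram_mult d (ell \<gamma> \<pi>)) = \<gamma>"
    and "is_sigma k lam c \<sigma> \<longleftrightarrow> \<sigma> = ell_factor \<pi> (diagram_mult d (ell \<gamma> \<pi>))"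
proof -
  let ?m = "merge (ubp_bot d) (block_map_inv d)"
  obtain \<gamma>' where \<gamma>': "c = diagram_of \<gamma>' ?m" "refines {1..k} (ubp_bot d) \<gamma>'" "?m ` \<gamma>' = \<gamma>'"
    "set_partition_type \<gamma>' = lam"
    using c coarsenings_iff[OF d] by blast
  then have "\<gamma>' = \<gamma>" by (simp add: \<gamma>_def)
  with \<gamma>' show eq: "c = diagram_of \<gamma> ?m" and ref: "refines {1..k} (ubp_bot d) \<gamma>"
    and type: "set_partition_type \<gamma> = lam"
    by simp_all
  have image: "?m ` \<gamma> = \<gamma>" using \<open>?m ` \<gamma>' = \<gamma>'\<close> \<open>\<gamma>' = \<gamma>\<close> by simp
  have part: "partition_on {1..k} \<gamma>" using ref by (simp add: refines_def)
  note e = ell_in_L_class[OF part type]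
  have dl: "diagram_mult d (ell \<gamma> \<pi>) = diagram_of \<pi> (\<lambda>A. ?m (block_map_inv (ell \<gamma> \<pi>) A))"
    "diagram_mult d (ell \<gamma> \<pi>) \<in> L_class k lam"
    using mult_L_class[OF d e(4)] ref unfolding e(5) by blast+
  have dl_m: "diagram_mult d (ell \<gamma> \<pi>) = diagram_of \<pi> (\<lambda>A. ?m (ell_map \<gamma> \<pi> A))"
    unfolding dl(1) by (rule diagram_of_cong) (simp add: e(1))
  show top: "ubp_top (diagram_mult d (ell \<gamma> \<pi>)) = \<gamma>"
    unfolding dl_m using e(3) image by (simp flip: image_image)
  have bij: "block_bij k \<gamma> ?m"
    by (rule block_bij_merge[OF block_bij_block_map_inv[OF d] ref])
  have "diagram_mult c (ell \<gamma> \<pi>) = diagram_mult d (ell \<gamma> \<pi>)"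
    unfolding dl_m unfolding eq e(1) by (rule diagram_mult_exact[OF bij e(2,3)])
  then have "is_sigma k lam c \<sigma> \<longleftrightarrow>
      \<sigma> \<in> G_group k lam \<and> diagram_mult (ell \<gamma> \<pi>) \<sigma> = diagram_mult d (ell \<gamma> \<pi>)"
    unfolding is_sigma_def UBP_mult \<gamma>_def[symmetric] by metis
  then show "is_sigma k lam c \<sigma> \<longleftrightarrow> \<sigma> = ell_factor \<pi> (diagram_mult d (ell \<gamma> \<pi>))"
    using mult_ell_iff[OF dl(2), of \<sigma>] ell_factor_in(1)[OF dl(2)] unfolding top by blast
qed

lemma monoid_character_eq_sum_coarsenings:
  assumes d: "d \<in> carrier (UBP k)"
  shows "monoid_character k lams d = (\<Sum>c\<in>coarsenings k d lam. group_character k lams (sigma k lam c))"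
proof -
  let ?m = "merge (ubp_bot d) (block_map_inv d)"
  let ?R = "(\<lambda>l. ell (ubp_top l) \<pi>) ` L_class k lam"
  let ?T = "{r. r \<in> ?R \<and> diagram_mult d r \<in> L_class k lam \<and> ell (ubp_top (diagram_mult d r)) \<pi> = r}"
  have "(\<Sum>c\<in>coarsenings k d lam. group_character k lams (sigma k lam c)) =
    (\<Sum>r\<in>?T. group_character k lams (ell_factor \<pi> (diagram_mult d r)))"
  \<comment> \<open>Both index sets are copies of the set of invariant \<open>\<gamma>\<close>: a
    coarsening has top \<open>\<gamma>\<close>, and the matching representative is
    \<open>ell \<gamma> \<pi>\<close>.\<close>
  proof (rule sum.reindex_bij_witness[where i = "\<lambda>r. diagram_of (ubp_top r) ?m"
        and j = "\<lambda>c. ell (ubp_top c) \<pi>"])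
    fix c assume c: "c \<in> coarsenings k d lam"
    note s = coarsening_sigma[OF d c]
    have e: "ell (ubp_top c) \<pi> \<in> L_class k lam" "ubp_top (ell (ubp_top c) \<pi>) = ubp_top c"
      using ell_in_L_class(4,5)[OF _ s(2)] s(1) by (auto simp: refines_def)
    show "diagram_of (ubp_top (ell (ubp_top c) \<pi>)) ?m = c"
      using s(3) e by simp
    have "ell (ubp_top c) \<pi> \<in> ?R" using e by (metis imageI)
    then show "ell (ubp_top c) \<pi> \<in> ?T"
      using mult_L_class(1)[OF d e(1)] s(1,4) e(2) by simp
    show "group_character k lams (ell_factor \<pi> (diagram_mult d (ell (ubp_top c) \<pi>))) =
        group_character k lams (sigma k lam c)"
      using s(5) by (simp add: sigma_def)
  next
    fix r assume r: "r \<in> ?T"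
    then obtain l where l: "l \<in> L_class k lam" "r = ell (ubp_top l) \<pi>" by blast
    note e = ell_in_L_class[OF L_classD(4,5)[OF l(1)]]
    have rL: "r \<in> L_class k lam" and top: "ubp_top r = ubp_top l" using e l by auto
    have dr: "diagram_mult d r \<in> L_class k lam" "ell (ubp_top (diagram_mult d r)) \<pi> = r" using r by auto
    then have ref: "refines {1..k} (ubp_bot d) (ubp_top r)" using mult_L_class(1)[OF d rL] by simp
    have "ubp_top (diagram_mult d r) = ?m ` ubp_top r"
      using mult_L_class(2)[OF d rL ref] L_classD(3)[OF rL] by (simp add: image_image)
    \<comment> \<open>\<open>ell \<gamma> \<pi>\<close> has top \<open>\<gamma>\<close>, so the
      fixed-point condition on representatives becomes one on tops.\<close>
    moreover have "ubp_top (diagram_mult d r) = ubp_top r"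
      using ell_in_L_class(5)[OF L_classD(4,5)[OF dr(1)]] dr(2) by simp
    ultimately have image: "?m ` ubp_top r = ubp_top r" by simp
    then show "diagram_of (ubp_top r) ?m \<in> coarsenings k d lam"
      unfolding coarsenings_iff[OF d] using ref L_classD(5)[OF rL] by blast
    show "ell (ubp_top (diagram_of (ubp_top r) ?m)) \<pi> = r"
      using image top l(2) by simp
  qed
  then show ?thesis using monoid_character_eq_sum_reps[OF d] by simp
qed

end

theorem proposition4p6:
  fixes k :: nat and lams mus :: "nat \<Rightarrow> nat multiset" and lam :: "nat multiset"
    and d_mu :: diagram
  assumes "k \<ge> 1"
    and "lams \<in> vector_partitions k"
    and "lam = vector_type k lams"
    and "mus \<in> vector_partitions k"
    and "d_mu \<in> gen_conj_class k mus"
  shows "(\<forall>d\<in>coarsenings k d_mu lam. \<exists>!\<sigma>. is_sigma k lam d \<sigma>) \<and>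
    monoid_character k lams d_mu =
      (\<Sum>d\<in>coarsenings k d_mu lam. group_character k lams (sigma k lam d))"
proof -
  have d: "d_mu \<in> carrier (UBP k)" using assms(5) by (simp add: gen_conj_class_def)
  show ?thesis
    unfolding assms(3)
    using coarsening_sigma(5)[OF assms(2) d] monoid_character_eq_sum_coarsenings[OF assms(2) d]
    by blast
qed

end
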